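(* Let $\mathcal{G}$ be a connected metric graph with vertex set $\mathsf{V}$ and let $\alpha \in [0,\infty)^{\mathsf{V}}$ be such that at least one $\alpha_{\mathsf{v}}$ is strictly positive. Then $$T(\mathcal{G},\alpha)=\sup_{u}\frac{\left(\int_{\mathcal{G}}|u|\,\mathrm{d}x\right)^2}{h_\alpha(u)}=\max_{u}\frac{\|u\|_{L^1(\mathcal{G})}^2}{h_\alpha(u)},$$ where $u$ ranges over the non-zero elements of $H^1(\mathcal{G})$. Furthermore, a non-zero $u\in H^1(\mathcal{G})$ attains this maximum if and only if it is a (non-zero) scalar multiple of the torsion function of $(\mathcal{G},\alpha)$.
   Context: A metric graph $\mathcal{G}$ is a finite collection of intervals glued together at their endpoints according to a finite combinatorial graph $(\mathsf{V},\mathsf{E})$ (loops and multiple edges allowed); each edge $\mathsf{e}\in\mathsf{E}$ is identified with $[0,\ell_{\mathsf{e}}]$, $\ell_{\mathsf{e}}\in(0,\infty)$. It carries Lebesgue measure and the shortest-path metric. It is connected if any two points are joined by a continuous path. $\mathsf{E}_{\mathsf{v}}$ is the collection of edges incident to $\mathsf{v}$ (a loop at $\mathsf{v}$ counted twice, once for each endpoint), $u_{\mathsf{e}}$ is the restriction of $u$ to $\mathsf{e}$, and $\frac{\partial u_{\mathsf{e}}}{\partial n}(\mathsf{v})$ is the derivative of $u_{\mathsf{e}}$ at the endpoint $\mathsf{v}$ in the direction pointing into $\mathsf{v}$. $H^1(\mathcal{G})$ is the space of functions $u=(u_{\mathsf{e}})_{\mathsf{e}\in\mathsf{E}}\in\bigoplus_{\mathsf{e}\in\mathsf{E}}H^1(0,\ell_{\mathsf{e}})$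 that are continuous at every vertex. For $\alpha\in\mathbb{R}^{\mathsf{V}}$ (the strengths), $h_\alpha(u)=\int_{\mathcal{G}}|u'(x)|^2\,\mathrm{d}x+\sum_{\mathsf{v}\in\mathsf{V}}\alpha_{\mathsf{v}}|u(\mathsf{v})|^2$ for $u\in H^1(\mathcal{G})$. The operator $-\Delta_{\mathcal{G},\alpha}$ is the self-adjoint operator in $L^2(\mathcal{G})$ associated with $h_\alpha$: it acts as $u\mapsto -u''$ on each edge, on functions that are edgewise in $H^2(0,\ell_{\mathsf{e}})$, continuous at every vertex, and satisfy $\sum_{\mathsf{e}\in\mathsf{E}_{\mathsf{v}}}\frac{\partial u_{\mathsf{e}}}{\partial n}(\mathsf{v})+\alpha_{\mathsf{v}}u(\mathsf{v})=0$ for all $\mathsf{v}\in\mathsf{V}$. The torsion function $\upsilon$ is the unique solution of $-\Delta_{\mathcal{G},\alpha}\upsilon=1$ (it exists and is strictly positive when $\mathcal{G}$ is connected and $\alpha\in[0,\infty)^{\mathsf{V}}$ is not identically zero), and the torsional rigidity is $T(\mathcal{G},\alpha)=\int_{\mathcal{G}}\upsilon(x)\,\mathrm{d}x$. *)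

theory Defs
  imports "HOL-Analysis.Analysis" "Graph_Theory.Digraph"
begin

section \<open>Metric graphs\<close>

text \<open>
  The combinatorial graph is a finite multigraph with loops. The direction of an arc \<open>e\<close> only
  records the identification of the edge with \<open>[0, len e]\<close>: the endpoint \<open>0\<close> is glued to \<open>tail G e\<close>
  and \<open>len e\<close> to \<open>head G e\<close>. Vertices arise from gluing endpoints of intervals, so every vertex is
  an endpoint of some edge.
\<close>

locale metric_graph = fin_digraph G for G :: "('v, 'e) pre_digraph" +
  fixes len :: "'e \<Rightarrow> real"
  assumes length_pos: "e \<in> arcs G \<Longrightarrow> 0 < len e"
    and verts_incident: "v \<in> verts G \<Longrightarrow> \<exists>e\<in>arcs G. tail G e = v \<or> head G e = v"

datatype ('v, 'e) point = Vertex 'v | Interior 'e real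

definition glue :: "('v, 'e) pre_digraph \<Rightarrow> ('e \<Rightarrow> real) \<Rightarrow> 'e \<times> real \<Rightarrow> ('v, 'e) point" where
  "glue G len = (\<lambda>(e, x). if x = 0 then Vertex (tail G e)
                       else if x = len e then Vertex (head G e)
                       else Interior e x)"

definition edge_space :: "('v, 'e) pre_digraph \<Rightarrow> ('e \<Rightarrow> real) \<Rightarrow> ('e \<times> real) topology" where
  "edge_space G len = sum_topology (\<lambda>e. top_of_set {0..len e}) (arcs G)"

text \<open>
  The quotient topology of the gluing; as the graph is finite, it is also the topology of the
  shortest-path metric.
\<close>

definition graph_space :: "('v, 'e) pre_digraph \<Rightarrow> ('e \<Rightarrow> real) \<Rightarrow> ('v, 'e) point topology" where
  "graph_space G len = topology (\<lambda>U. U \<subseteq> glue G len ` topspace (edge_space G len) \<and>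
     openin (edge_space G len) {p \<in> topspace (edge_space G len). glue G len p \<in> U})"

lemma openin_graph_space:
  "openin (graph_space G len) U \<longleftrightarrow> U \<subseteq> glue G len ` topspace (edge_space G len) \<and>
     openin (edge_space G len) {p \<in> topspace (edge_space G len). glue G len p \<in> U}"
proof -
  let ?X = "edge_space G len" and ?f = "glue G len"
  have 1: "{p \<in> topspace ?X. ?f p \<in> S \<inter> T} =
      {p \<in> topspace ?X. ?f p \<in> S} \<inter> {p \<in> topspace ?X. ?f p \<in> T}" for S T
    by auto
  have 2: "{p \<in> topspace ?X. ?f p \<in> \<Union>K} = (\<Union>S\<in>K. {p \<in> topspace ?X. ?f p \<in> S})" for K
    by auto
  have "istopology (\<lambda>U. U \<subseteq> ?f ` topspace ?X \<and> openin ?X {p \<in> topspace ?X. ?f p \<in> U})"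
    unfolding istopology_def 1 2 by blast
  then show ?thesis
    by (simp add: graph_space_def)
qed

lemma topspace_graph_space: "topspace (graph_space G len) = glue G len ` topspace (edge_space G len)"
proof (rule antisym)
  show "topspace (graph_space G len) \<subseteq> glue G len ` topspace (edge_space G len)"
    using openin_graph_space openin_topspace by blast
  have "{p \<in> topspace (edge_space G len). glue G len p \<in> glue G len ` topspace (edge_space G len)} =
      topspace (edge_space G len)"
    by auto
  then have "openin (graph_space G len) (glue G len ` topspace (edge_space G len))"
    by (simp add: openin_graph_space)
  then show "glue G len ` topspace (edge_space G len) \<subseteq> topspace (graph_space G len)"
    by (rule openin_subset)
qed

lemma quotient_map_glue: "quotient_map (edge_space G len) (graph_space G len) (glue G len)"
  by (simp add: quotient_map_def topspace_graph_space openin_graph_space)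

definition restrict_edge ::
    "('v, 'e) pre_digraph \<Rightarrow> ('e \<Rightarrow> real) \<Rightarrow> (('v, 'e) point \<Rightarrow> 'a) \<Rightarrow> 'e \<Rightarrow> real \<Rightarrow> 'a" where
  "restrict_edge G len u e x = u (glue G len (e, x))"

text \<open>
  The elements of \<open>E\<^sub>v\<close> as pairs of an edge and an endpoint of it; a loop at \<open>v\<close>
  contributes two pairs.
\<close>

definition edge_ends :: "('v, 'e) pre_digraph \<Rightarrow> ('e \<Rightarrow> real) \<Rightarrow> 'v \<Rightarrow> ('e \<times> real) set" where
  "edge_ends G len v =
     {(e, x). e \<in> arcs G \<and> (x = 0 \<and> tail G e = v \<or> x = len e \<and> head G e = v)}"

definition graph_integral ::
    "('v, 'e) pre_digraph \<Rightarrow> ('e \<Rightarrow> real) \<Rightarrow>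
     (('v, 'e) point \<Rightarrow> 'a::{banach, second_countable_topology}) \<Rightarrow> 'a" where
  "graph_integral G len f =
     (\<Sum>e\<in>arcs G. \<integral>x. restrict_edge G len f e x \<partial>lebesgue_on {0<..<len e})"


section \<open>Sobolev spaces on an interval\<close>

text \<open>
  Membership in these sets only depends on the almost-everywhere class of a function on \<open>(0, l)\<close>.
\<close>

definition L2 :: "real \<Rightarrow> (real \<Rightarrow> complex) set" where
  "L2 l = {f \<in> borel_measurable (lebesgue_on {0<..<l}).
             integrable (lebesgue_on {0<..<l}) (\<lambda>x. (cmod (f x))\<^sup>2)}"

text \<open>
  The test functions are those of class \<open>C\<^sup>1\<close> with compact support in \<open>(0, l)\<close>; by mollification
  they give the same weak derivatives as those of class \<open>C\<^sup>\<infinity>\<close>.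
\<close>

definition test_functions :: "real \<Rightarrow> (real \<Rightarrow> real) set" where
  "test_functions l =
     {\<phi>. \<phi> C1_differentiable_on UNIV \<and> closure {x. \<phi> x \<noteq> 0} \<subseteq> {0<..<l}}"

definition has_weak_deriv :: "real \<Rightarrow> (real \<Rightarrow> complex) \<Rightarrow> (real \<Rightarrow> complex) \<Rightarrow> bool" where
  "has_weak_deriv l f g \<longleftrightarrow> (\<forall>\<phi>\<in>test_functions l.
     (\<integral>x. f x * of_real (deriv \<phi> x) \<partial>lebesgue_on {0<..<l}) =
     - (\<integral>x. g x * of_real (\<phi> x) \<partial>lebesgue_on {0<..<l}))"

text \<open>The weak derivative is determined up to null sets; this chooses a representative.\<close>

definition weak_deriv :: "real \<Rightarrow> (real \<Rightarrow> complex) \<Rightarrow> real \<Rightarrow> complex" where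
  "weak_deriv l f = (SOME g. g \<in> L2 l \<and> has_weak_deriv l f g)"

definition H1 :: "real \<Rightarrow> (real \<Rightarrow> complex) set" where
  "H1 l = {f \<in> L2 l. \<exists>g\<in>L2 l. has_weak_deriv l f g}"

definition H2 :: "real \<Rightarrow> (real \<Rightarrow> complex) set" where
  "H2 l = {f \<in> H1 l. weak_deriv l f \<in> H1 l}"


section \<open>Function spaces and operators on a metric graph\<close>

text \<open>
  Elements of \<open>H\<^sup>1\<close> of the graph are represented by their continuous representatives, extended by
  zero to values of type \<open>point\<close> that are not points of the graph. Hence equality of functions
  is equality in \<open>H\<^sup>1\<close>. Continuity on the graph amounts to continuity on every closed edge and
  at every vertex.
\<close>

definition H1_graph ::
    "('v, 'e) pre_digraph \<Rightarrow> ('e \<Rightarrow> real) \<Rightarrow> (('v, 'e) point \<Rightarrow> complex) set" where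
  "H1_graph G len = {u. continuous_map (graph_space G len) euclidean u \<and>
     (\<forall>e\<in>arcs G. restrict_edge G len u e \<in> H1 (len e)) \<and>
     (\<forall>p. p \<notin> topspace (graph_space G len) \<longrightarrow> u p = 0)}"

definition energy_form ::
    "('v, 'e) pre_digraph \<Rightarrow> ('e \<Rightarrow> real) \<Rightarrow> ('v \<Rightarrow> real) \<Rightarrow> (('v, 'e) point \<Rightarrow> complex) \<Rightarrow> real" where
  "energy_form G len \<alpha> u =
     (\<Sum>e\<in>arcs G.
        \<integral>x. (cmod (weak_deriv (len e) (restrict_edge G len u e) x))\<^sup>2 \<partial>lebesgue_on {0<..<len e}) +
     (\<Sum>v\<in>verts G. \<alpha> v * (cmod (u (Vertex v)))\<^sup>2)"

text \<open>
  The derivative of \<open>u\<^sub>e\<close> at an endpoint \<open>x\<close> of \<open>e\<close>, in the direction from the edge into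
  the vertex. For \<open>u\<^sub>e\<close> in \<open>H\<^sup>2\<close> it exists as a classical one-sided derivative.
\<close>

definition normal_deriv ::
    "('v, 'e) pre_digraph \<Rightarrow> ('e \<Rightarrow> real) \<Rightarrow> (('v, 'e) point \<Rightarrow> complex) \<Rightarrow> 'e \<times> real \<Rightarrow> complex" where
  "normal_deriv G len u = (\<lambda>(e, x).
     let d = vector_derivative (restrict_edge G len u e) (at x within {0..len e})
     in if x = 0 then - d else d)"

definition laplacian_domain ::
    "('v, 'e) pre_digraph \<Rightarrow> ('e \<Rightarrow> real) \<Rightarrow> ('v \<Rightarrow> real) \<Rightarrow> (('v, 'e) point \<Rightarrow> complex) set" where
  "laplacian_domain G len \<alpha> = {u \<in> H1_graph G len.
     (\<forall>e\<in>arcs G. restrict_edge G len u e \<in> H2 (len e)) \<and>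
     (\<forall>v\<in>verts G. (\<Sum>p\<in>edge_ends G len v. normal_deriv G len u p) + of_real (\<alpha> v) * u (Vertex v) = 0)}"

definition neg_laplacian ::
    "('v, 'e) pre_digraph \<Rightarrow> ('e \<Rightarrow> real) \<Rightarrow> (('v, 'e) point \<Rightarrow> complex) \<Rightarrow> 'e \<Rightarrow> real \<Rightarrow> complex" where
  "neg_laplacian G len u e x = - weak_deriv (len e) (weak_deriv (len e) (restrict_edge G len u e)) x"

definition torsion_function ::
    "('v, 'e) pre_digraph \<Rightarrow> ('e \<Rightarrow> real) \<Rightarrow> ('v \<Rightarrow> real) \<Rightarrow> ('v, 'e) point \<Rightarrow> complex" where
  "torsion_function G len \<alpha> = (THE u. u \<in> laplacian_domain G len \<alpha> \<and>
     (\<forall>e\<in>arcs G. AE x in lebesgue_on {0<..<len e}. neg_laplacian G len u e x = 1))"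

text \<open>
  The torsion function is positive, hence the torsional rigidity is real; as an integral of a
  complex-valued function it has type \<open>complex\<close>.
\<close>

definition torsional_rigidity ::
    "('v, 'e) pre_digraph \<Rightarrow> ('e \<Rightarrow> real) \<Rightarrow> ('v \<Rightarrow> real) \<Rightarrow> complex" where
  "torsional_rigidity G len \<alpha> = graph_integral G len (torsion_function G len \<alpha>)"

definition L1_norm ::
    "('v, 'e) pre_digraph \<Rightarrow> ('e \<Rightarrow> real) \<Rightarrow> (('v, 'e) point \<Rightarrow> complex) \<Rightarrow> real" where
  "L1_norm G len u = graph_integral G len (\<lambda>p. cmod (u p))"

definition torsion_quotient ::
    "('v, 'e) pre_digraph \<Rightarrow> ('e \<Rightarrow> real) \<Rightarrow> ('v \<Rightarrow> real) \<Rightarrow> (('v, 'e) point \<Rightarrow> complex) \<Rightarrow> real" where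
  "torsion_quotient G len \<alpha> u = (L1_norm G len u)\<^sup>2 / energy_form G len \<alpha> u"

end

theory Submission
  imports Defs "Jordan_Normal_Form.Determinant"
begin

text \<open>
  The torsion function \<open>\<upsilon>\<close> is positive and \<open>-\<upsilon>'' = 1\<close>, so testing its equation with \<open>\<bar>u\<bar>\<^sup>2 / \<upsilon>\<close>
  gives the Picone identity
  \<open>h\<^sub>\<alpha>(u) = \<integral> \<bar>u\<bar>\<^sup>2 / \<upsilon> + \<integral> \<bar>u' - u \<upsilon>' / \<upsilon>\<bar>\<^sup>2\<close>, in which the vertex conditions of \<open>\<upsilon>\<close> cancel the
  boundary terms. By Cauchy-Schwarz, \<open>(\<integral> \<bar>u\<bar>)\<^sup>2 \<le> \<integral> \<upsilon> \<cdot> \<integral> \<bar>u\<bar>\<^sup>2 / \<upsilon>\<close>, which bounds the quotient by the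
  torsional rigidity. Equality forces \<open>(u / \<upsilon>)' = 0\<close> on every edge, and then \<open>u / \<upsilon>\<close> is constant since
  the graph is connected; multiples of \<open>\<upsilon>\<close> attain equality in both steps.

  On an edge \<open>\<upsilon>\<close> is a quadratic polynomial determined by its two vertex values, so its existence
  and uniqueness reduce to an injective linear system for the vertex values, and its positivity to
  a minimum principle for that system.
\<close>

section \<open>Indefinite integrals\<close>

text \<open>Membership in \<open>H1\<close> is a statement about weak derivatives, and
  \<open>weak_deriv\<close> is an arbitrary choice among functions that agree almost everywhere. The
  Picone identity, however, needs a product rule and boundary values on closed edges. The predicate
  \<open>abs_cont\<close> is the bridge: \<open>F\<close> is an indefinite Lebesgue integral of
  \<open>f\<close>, and a continuous element of \<open>H1\<close> has this form with its weak
  derivative as \<open>f\<close>. The integrals over \<open>{0..x}\<close> are gauge integrals, for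
  which the calculus on intervals is available; absolute integrability ties them to the Lebesgue
  integrals of the definitions. The quotient of \<bar>u\<bar> squared by \<upsilon> is harmless
  because \<upsilon> is positive on closed edges, vertices included, so that its logarithmic
  derivative is continuous up to the ends. Moreover \<upsilon> is an explicit parabola on each edge,
  so the only Sobolev function that enters the identity is u itself.\<close>

definition abs_cont :: "real \<Rightarrow> (real \<Rightarrow> complex) \<Rightarrow> (real \<Rightarrow> complex) \<Rightarrow> bool" where
  "abs_cont l F f \<longleftrightarrow> f absolutely_integrable_on {0..l} \<and>
     (\<forall>x\<in>{0..l}. (f has_integral F x - F 0) {0..x})"

text \<open>Passes from the Lebesgue measure on the open edge, used in the definitions, to absolute
  gauge integrability on the closed edge, used for calculus; the two endpoints form a null
  set.\<close>

lemma integrable_lebesgue_on_Ioo_iff: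
  fixes f :: "real \<Rightarrow> 'a::euclidean_space"
  shows "integrable (lebesgue_on {0<..<l}) f \<longleftrightarrow> f absolutely_integrable_on {0..l}"
proof -
  have "integrable (lebesgue_on {0<..<l}) f \<longleftrightarrow> f absolutely_integrable_on {0<..<l}"
    by (simp add: integrable_restrict_space set_integrable_def)
  also have "\<dots> \<longleftrightarrow> f absolutely_integrable_on {0..l}"
    using absolutely_integrable_on_open_interval[where f=f and a=0 and b=l] by simp
  finally show ?thesis .
qed

lemma integral_lebesgue_on_Ioo:
  fixes f :: "real \<Rightarrow> 'a::euclidean_space"
  assumes "f absolutely_integrable_on {0..l}"
  shows "integral\<^sup>L (lebesgue_on {0<..<l}) f = integral {0..l} f"
  using assms lebesgue_integral_eq_integral[of "{0<..<l}" f]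
  by (simp add: integrable_lebesgue_on_Ioo_iff integral_open_interval_real)

text \<open>A form of the mean value inequality in which \<open>m\<close> need not be differentiable.\<close>

lemma const_of_small_increments:
  fixes D :: "real \<Rightarrow> 'a::real_normed_vector" and m :: "real \<Rightarrow> real"
  assumes "a \<le> b"
    and small: "\<And>\<epsilon> x. 0 < \<epsilon> \<Longrightarrow> a \<le> x \<Longrightarrow> x \<le> b \<Longrightarrow> \<exists>d>0. \<forall>s t. a \<le> s \<and> s \<le> x \<and> x \<le> t \<and> t \<le> b \<and> t - s < d \<longrightarrow>
        norm (D t - D s) \<le> \<epsilon> * (m t - m s)"
  shows "D b = D a"
proof -
  have bound: "norm (D b - D a) \<le> \<epsilon> * (m b - m a)" if "0 < \<epsilon>" for \<epsilon>
  proof -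
    have "a \<le> a \<and> b \<le> b \<longrightarrow> norm (D b - D a) \<le> \<epsilon> * (m b - m a)"
      using \<open>a \<le> b\<close>
    \<comment> \<open>Bisection: the estimate adds up over adjacent intervals, so its validity on
      all short intervals around each point gives it on \<open>{a..b}\<close>.\<close>
    proof (rule Bolzano[where P = "\<lambda>s t. a \<le> s \<and> t \<le> b \<longrightarrow> norm (D t - D s) \<le> \<epsilon> * (m t - m s)"])
      fix r s t
      assume *: "a \<le> r \<and> s \<le> b \<longrightarrow> norm (D s - D r) \<le> \<epsilon> * (m s - m r)"
        "a \<le> s \<and> t \<le> b \<longrightarrow> norm (D t - D s) \<le> \<epsilon> * (m t - m s)" "r \<le> s" "s \<le> t"
      show "a \<le> r \<and> t \<le> b \<longrightarrow> norm (D t - D r) \<le> \<epsilon> * (m t - m r)"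
      proof
        assume "a \<le> r \<and> t \<le> b"
        then have "norm (D s - D r) \<le> \<epsilon> * (m s - m r)" "norm (D t - D s) \<le> \<epsilon> * (m t - m s)"
          using * by auto
        then show "norm (D t - D r) \<le> \<epsilon> * (m t - m r)"
          using norm_triangle_ineq[of "D t - D s" "D s - D r"] by (simp add: algebra_simps)
      qed
    next
      fix x assume "a \<le> x" "x \<le> b"
      then obtain d where "d > 0" and "\<forall>s t. a \<le> s \<and> s \<le> x \<and> x \<le> t \<and> t \<le> b \<and> t - s < d \<longrightarrow>
          norm (D t - D s) \<le> \<epsilon> * (m t - m s)"
        using small[OF \<open>0 < \<epsilon>\<close>] by blast
      then show "\<exists>d>0. \<forall>s t. s \<le> x \<and> x \<le> t \<and> t - s < d \<longrightarrow>
          a \<le> s \<and> t \<le> b \<longrightarrow> norm (D t - D s) \<le> \<epsilon> * (m t - m s)"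
        by blast
    qed
    then show ?thesis by simp
  qed
  have "norm (D b - D a) \<le> 0"
  proof (rule field_le_epsilon)
    fix \<epsilon> :: real assume "0 < \<epsilon>"
    \<comment> \<open>The summand 1 keeps the divisor positive when
      \<open>m b = m a\<close>.\<close>
    let ?k = "\<bar>m b - m a\<bar> + 1"
    have "norm (D b - D a) \<le> \<epsilon> / ?k * (m b - m a)"
      using bound[of "\<epsilon> / ?k"] \<open>0 < \<epsilon>\<close> by simp
    also have "\<dots> \<le> \<epsilon> / ?k * ?k"
      using \<open>0 < \<epsilon>\<close> by (intro mult_left_mono) auto
    also have "\<dots> = \<epsilon>" by (simp add: add_nonneg_eq_0_iff)
    finally show "norm (D b - D a) \<le> 0 + \<epsilon>" by simp
  qed
  then show ?thesis by simp
qed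

lemma abs_cont_integrable: "abs_cont l F f \<Longrightarrow> f absolutely_integrable_on {0..l}"
  by (simp add: abs_cont_def)

lemma abs_cont_has_integral:
  assumes "abs_cont l F f" "0 \<le> s" "s \<le> t" "t \<le> l"
  shows "(f has_integral F t - F s) {s..t}"
proof -
  have s: "(f has_integral F s - F 0) {0..s}" and t: "(f has_integral F t - F 0) {0..t}"
    using assms by (auto simp: abs_cont_def)
  then have "f integrable_on {s..t}"
    using assms(2,3) by (meson has_integral_integrable integrable_on_subinterval atLeastatMost_subset_iff order_refl)
  then obtain j where j: "(f has_integral j) {s..t}" by blast
  have "(f has_integral F s - F 0 + j) {0..t}"
    using has_integral_combine[OF assms(2,3) s j] .
  then have "F s - F 0 + j = F t - F 0"
    using t has_integral_unique by blast
  then have "j = F t - F s" by (simp add: algebra_simps)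
  with j show ?thesis by simp
qed

lemma abs_cont_continuous:
  assumes "abs_cont l F f"
  shows "continuous_on {0..l} F"
proof -
  have "f integrable_on {0..l}"
    using assms absolutely_integrable_on_def abs_cont_integrable by blast
  then have "continuous_on {0..l} (\<lambda>x. F 0 + integral {0..x} f)"
    by (intro continuous_intros indefinite_integral_continuous_1)
  then show ?thesis
    by (rule continuous_on_eq) (use assms in \<open>auto simp: abs_cont_def dest!: integral_unique bspec\<close>)
qed

lemma absolutely_integrable_mult_continuous:
  fixes f g :: "real \<Rightarrow> complex"
  assumes "f absolutely_integrable_on {a..b}" "continuous_on {a..b} g"
  shows "(\<lambda>x. f x * g x) absolutely_integrable_on {a..b}"
proof -
  have "(\<lambda>x. g x * f x) absolutely_integrable_on {a..b}"
  proof (rule absolutely_integrable_bounded_measurable_product[where h="(*)"])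
    show "bilinear ((*) :: complex \<Rightarrow> complex \<Rightarrow> complex)"
      using bilinear_conv_bounded_bilinear bounded_bilinear_mult by blast
    show "g \<in> borel_measurable (lebesgue_on {a..b})"
      using assms(2) by (intro continuous_imp_measurable_on_sets_lebesgue) auto
    show "bounded (g ` {a..b})"
      using assms(2) compact_continuous_image compact_imp_bounded by blast
  qed (use assms in auto)
  then show ?thesis by (simp add: mult.commute)
qed

section \<open>Product rule for indefinite integrals\<close>

text \<open>
  The increments of \<open>F * G\<close> and of the integral of \<open>f * G + g * F\<close> over \<open>[s, t]\<close> differ by the integral of
  \<open>f r * (G t - G r) + g r * (F s - F r)\<close>, which is small relative to \<open>\<integral> \<bar>f\<bar> + \<bar>g\<bar>\<close> as \<open>F\<close> and \<open>G\<close> are continuous.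
\<close>

lemma abs_cont_mult:
  assumes F: "abs_cont l F f" and G: "abs_cont l G g"
  shows "abs_cont l (\<lambda>x. F x * G x) (\<lambda>x. f x * G x + g x * F x)"
proof -
  let ?k = "\<lambda>x. f x * G x + g x * F x"
  let ?n = "\<lambda>x. norm (f x) + norm (g x)"
  have cF: "continuous_on {0..l} F" and cG: "continuous_on {0..l} G"
    using F G abs_cont_continuous by auto
  have k: "?k absolutely_integrable_on {0..l}"
    by (intro set_integral_add absolutely_integrable_mult_continuous abs_cont_integrable[OF F]
        abs_cont_integrable[OF G] cF cG)
  have n: "?n integrable_on {0..l}"
    using abs_cont_integrable[OF F] abs_cont_integrable[OF G]
    by (auto simp: absolutely_integrable_on_def intro: integrable_add)
  have kI: "?k integrable_on {0..l}" using k absolutely_integrable_on_def by blast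
  have main: "F x * G x - integral {0..x} ?k = F 0 * G 0 - integral {0..0} ?k" if x: "x \<in> {0..l}" for x
  proof (rule const_of_small_increments[where m="\<lambda>x. integral {0..x} ?n"])
    show "0 \<le> x" using x by simp
  next
    fix \<epsilon> z :: real assume e: "0 < \<epsilon>" and z: "0 \<le> z" "z \<le> x"
    \<comment> \<open>Half of \<epsilon>, because values at two points of \<open>{s..t}\<close> will
      be compared through the value at \<open>z\<close>.\<close>
    obtain d1 where d1: "d1 > 0" "\<And>w. w \<in> {0..l} \<Longrightarrow> dist w z < d1 \<Longrightarrow> dist (F w) (F z) < \<epsilon>/2"
      using cF e z x unfolding continuous_on_iff by (metis atLeastAtMost_iff half_gt_zero order_trans)
    obtain d2 where d2: "d2 > 0" "\<And>w. w \<in> {0..l} \<Longrightarrow> dist w z < d2 \<Longrightarrow> dist (G w) (G z) < \<epsilon>/2"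
      using cG e z x unfolding continuous_on_iff by (metis atLeastAtMost_iff half_gt_zero order_trans)
    have "norm (F t * G t - integral {0..t} ?k - (F s * G s - integral {0..s} ?k))
         \<le> \<epsilon> * (integral {0..t} ?n - integral {0..s} ?n)"
      if st: "0 \<le> s" "s \<le> z" "z \<le> t" "t \<le> x" "t - s < min d1 d2" for s t
    proof -
      have sub: "{s..t} \<subseteq> {0..l}" "{0..t} \<subseteq> {0..l}" using st x by auto
      have kst: "?k integrable_on {s..t}" and nst: "?n integrable_on {s..t}"
        using integrable_on_subinterval[OF kI sub(1)] integrable_on_subinterval[OF n sub(1)] .
      have kc: "integral {0..t} ?k = integral {0..s} ?k + integral {s..t} ?k"
        by (rule Henstock_Kurzweil_Integration.integral_combine[symmetric])
          (use st integrable_on_subinterval[OF kI sub(2)] in auto)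
      have nc: "integral {0..t} ?n = integral {0..s} ?n + integral {s..t} ?n"
        by (rule Henstock_Kurzweil_Integration.integral_combine[symmetric])
          (use st integrable_on_subinterval[OF n sub(2)] in auto)
      have f: "(f has_integral F t - F s) {s..t}" and g: "(g has_integral G t - G s) {s..t}"
        using abs_cont_has_integral[OF F, of s t] abs_cont_has_integral[OF G, of s t] st x by auto
      \<comment> \<open>Freezing \<open>G\<close> at the right end and \<open>F\<close> at the left
        end makes this integral exact: its value is \<open>F t * G t - F s * G s\<close>.\<close>
      have "((\<lambda>r. f r * G t + g r * F s) has_integral (F t - F s) * G t + (G t - G s) * F s) {s..t}"
        by (intro has_integral_add has_integral_mult_left f g)
      then have "((\<lambda>r. (f r * G t + g r * F s) - ?k r) has_integral
          ((F t - F s) * G t + (G t - G s) * F s) - integral {s..t} ?k) {s..t}" (is "(?q has_integral ?j) _")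
        using kst by (intro has_integral_diff integrable_integral)
      moreover have "norm ((f r * G t + g r * F s) - ?k r) \<le> \<epsilon> * ?n r" if r: "r \<in> {s..t}" for r
      proof -
        have w: "dist (F w) (F z) < \<epsilon>/2" "dist (G w) (G z) < \<epsilon>/2" if "w \<in> {s..t}" for w
        proof -
          have "w \<in> {0..l}" "dist w z < d1" "dist w z < d2"
            using that st x by (auto simp: dist_real_def)
          then show "dist (F w) (F z) < \<epsilon>/2" "dist (G w) (G z) < \<epsilon>/2"
            using d1 d2 by blast+
        qed
        have "dist (G t) (G r) < \<epsilon>" "dist (F s) (F r) < \<epsilon>"
          using w[of t] w[of r] w[of s] r st dist_triangle_half_l by auto
        then have *: "norm (G t - G r) \<le> \<epsilon>" "norm (F s - F r) \<le> \<epsilon>" by (auto simp: dist_norm)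
        have "(f r * G t + g r * F s) - ?k r = f r * (G t - G r) + g r * (F s - F r)"
          by (simp add: algebra_simps)
        also have "norm \<dots> \<le> norm (f r) * norm (G t - G r) + norm (g r) * norm (F s - F r)"
          by (metis norm_mult norm_triangle_ineq)
        also have "\<dots> \<le> norm (f r) * \<epsilon> + norm (g r) * \<epsilon>"
          using * by (intro add_mono mult_left_mono) auto
        finally show ?thesis by (simp add: algebra_simps)
      qed
      ultimately have "norm (((F t - F s) * G t + (G t - G s) * F s) - integral {s..t} ?k)
          \<le> integral {s..t} (\<lambda>r. \<epsilon> * ?n r)"
        using integral_norm_bound_integral[of ?q "{s..t}" "\<lambda>r. \<epsilon> * ?n r"] nst
        by (simp add: has_integral_iff integrable_on_mult_right)
      also have "\<dots> = \<epsilon> * integral {s..t} ?n"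
        by simp
      finally show ?thesis
        using kc nc by (simp add: algebra_simps)
    qed
    then show "\<exists>d>0. \<forall>s t. 0 \<le> s \<and> s \<le> z \<and> z \<le> t \<and> t \<le> x \<and> t - s < d \<longrightarrow>
        norm (F t * G t - integral {0..t} ?k - (F s * G s - integral {0..s} ?k))
         \<le> \<epsilon> * (integral {0..t} ?n - integral {0..s} ?n)"
      using d1(1) d2(1) by (intro exI[of _ "min d1 d2"]) auto
  qed
  have "(?k has_integral F x * G x - F 0 * G 0) {0..x}" if x: "x \<in> {0..l}" for x
  proof -
    have "?k integrable_on {0..x}"
      using x by (intro integrable_on_subinterval[OF kI]) auto
    then show ?thesis
      using main[OF x] by (auto simp: has_integral_iff eq_diff_eq diff_eq_eq add.commute)
  qed
  with k show ?thesis by (simp add: abs_cont_def)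
qed

lemma abs_cont_of_deriv:
  assumes "\<And>x. x \<in> {0..l} \<Longrightarrow> (F has_vector_derivative f x) (at x within {0..l})"
    and "continuous_on {0..l} f"
  shows "abs_cont l F f"
  unfolding abs_cont_def
proof (intro conjI ballI)
  show "f absolutely_integrable_on {0..l}"
    by (intro absolutely_integrable_continuous_real assms)
  fix x assume x: "x \<in> {0..l}"
  show "(f has_integral F x - F 0) {0..x}"
    using x by (intro fundamental_theorem_of_calculus has_vector_derivative_within_subset[OF assms(1)]) auto
qed

lemma abs_cont_cnj:
  assumes "abs_cont l F f"
  shows "abs_cont l (\<lambda>x. cnj (F x)) (\<lambda>x. cnj (f x))"
  unfolding abs_cont_def
proof (intro conjI ballI)
  show "(\<lambda>x. cnj (f x)) absolutely_integrable_on {0..l}"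
    using absolutely_integrable_linear[OF abs_cont_integrable[OF assms] bounded_linear_cnj]
    by (simp add: o_def)
  fix x assume "x \<in> {0..l}"
  then have "(f has_integral F x - F 0) {0..x}"
    using assms by (simp add: abs_cont_def)
  then show "((\<lambda>x. cnj (f x)) has_integral cnj (F x) - cnj (F 0)) {0..x}"
    using has_integral_linear[OF _ bounded_linear_cnj, of f "F x - F 0"] by (simp add: o_def)
qed

lemma abs_cont_of_integral:
  assumes "f absolutely_integrable_on {0..l}"
  shows "abs_cont l (\<lambda>x. integral {0..x} f) f"
proof -
  have "f integrable_on {0..x}" if "x \<in> {0..l}" for x
    using assms integrable_on_subinterval[of f "{0..l}" 0 x] that by (auto simp: absolutely_integrable_on_def)
  then show ?thesis
    using assms by (simp add: abs_cont_def has_integral_iff)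
qed

section \<open>Weak derivatives on an interval\<close>

lemma borel_measurable_lebesgue_on: "f \<in> borel_measurable borel \<Longrightarrow> f \<in> borel_measurable (lebesgue_on S)"
  by (simp add: measurable_completion measurable_restrict_space1)

text \<open>The Borel sets on which the integral of the zero extension vanishes contain all
  half-lines and form a Dynkin system. The half-lines are stable under intersection and generate the
  Borel sets, so the density is zero almost everywhere.\<close>

lemma AE_zero_of_integrals_zero_real:
  fixes f :: "real \<Rightarrow> real"
  assumes f: "f absolutely_integrable_on {0..l}" and zero: "\<And>x. x \<in> {0..l} \<Longrightarrow> integral {0..x} f = 0"
  shows "AE x in lebesgue_on {0<..<l}. f x = 0"
proof -
  define F where "F = (\<lambda>x. indicator {0..l} x * f x)"
  have F: "integrable lebesgue F"
    using f by (simp add: F_def set_integrable_def)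
  \<comment> \<open>A Borel representative is needed because the half-lines generate the Borel sets
    but not the Lebesgue sets.\<close>
  obtain h where h: "h \<in> borel_measurable lborel" "AE x in lborel. F x = h x"
    using completion_ex_borel_measurable_real[OF borel_measurable_integrable[OF F]] by blast
  have hL: "h \<in> borel_measurable lebesgue" using h(1) by (rule measurable_completion)
  have aeL: "AE x in lebesgue. F x = h x" using h(2) by (rule AE_completion)
  have hi: "integrable lebesgue h"
    using F aeL hL integrable_cong_AE_imp[OF F hL] by (auto elim: AE_mp)
  have hb: "integrable lborel h"
    using hi h(1) integrable_completion by blast
  have hset: "set_integrable lborel A h" if "A \<in> sets borel" for A
    unfolding set_integrable_def using hb that by (intro integrable_mult_indicator) auto
  have upto: "set_lebesgue_integral lborel {..a} h = 0" for a
  proof -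
    have "set_lebesgue_integral lborel {..a} h = set_lebesgue_integral lebesgue {..a} h"
      unfolding set_lebesgue_integral_def
      by (intro integral_completion[symmetric]) (use h(1) in measurable)
    also have "\<dots> = set_lebesgue_integral lebesgue ({0..min a l}) f"
      unfolding set_lebesgue_integral_def
    proof (rule integral_cong_AE)
      show "(\<lambda>x. indicator {0..min a l} x *\<^sub>R f x) \<in> borel_measurable lebesgue"
        using absolutely_integrable_on_subinterval[OF f, of 0 "min a l"] by (auto simp: set_integrable_def)
      show "AE x in lebesgue. indicator {..a} x *\<^sub>R h x = indicator {0..min a l} x *\<^sub>R f x"
        using aeL by eventually_elim (auto simp: F_def indicator_def split: if_splits)
    qed (auto intro!: borel_measurable_times borel_measurable_indicator hL)
    also have "\<dots> = integral {0..min a l} f"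
      by (rule set_lebesgue_integral_eq_integral(2))
        (use absolutely_integrable_on_subinterval[OF f, of 0 "min a l"] in auto)
    also have "\<dots> = 0"
      by (cases "min a l < 0") (auto intro!: zero)
    finally show ?thesis .
  qed
  have "(UNIV :: real set) = (\<Union>n::nat. {..real n})"
    by (auto simp: real_arch_simple)
  then have UN: "set_lebesgue_integral lborel UNIV h = 0"
    using set_integral_cont_up[of "\<lambda>n. {..real n}" lborel h] hset[of UNIV] upto
    by (simp add: incseq_def LIMSEQ_const_iff)
  have all: "set_lebesgue_integral lborel A h = 0" if "A \<in> sets lborel" for A
  proof -
    have "Int_stable (range (atMost :: real \<Rightarrow> _))"
      by (auto simp: Int_stable_def)
    moreover have "range (atMost :: real \<Rightarrow> _) \<subseteq> Pow UNIV"
      by simp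
    moreover have "A \<in> sigma_sets UNIV (range atMost)"
      using that by (simp add: borel_eq_atMost)
    ultimately show ?thesis
    proof (induct rule: sigma_sets_induct_disjoint)
      case (basic A) then show ?case using upto by auto
    next
      case (compl A)
      then have A: "A \<in> sets borel" by (simp add: borel_eq_atMost)
      have "set_lebesgue_integral lborel (A \<union> (UNIV - A)) h =
          set_lebesgue_integral lborel A h + set_lebesgue_integral lborel (UNIV - A) h"
        using A by (intro set_integral_Un hset) auto
      then show ?case using compl UN by simp
    next
      case (union A)
      then have A: "\<And>i. A i \<in> sets borel" by (auto simp: borel_eq_atMost)
      have "set_lebesgue_integral lborel (\<Union>i. A i) h = (\<Sum>i. set_lebesgue_integral lborel (A i) h)"
        using A union by (intro lebesgue_integral_countable_add hset) (auto simp: disjoint_family_on_def)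
      then show ?case using union by simp
    qed (auto simp: set_lebesgue_integral_def)
  qed
  have "AE x in lborel. h x = 0"
    by (rule density_unique_real[OF hb]) (use all in \<open>auto simp: set_lebesgue_integral_def\<close>)
  then have "AE x in lebesgue. h x = 0" by (rule AE_completion)
  with aeL have "AE x in lebesgue. F x = 0" by eventually_elim auto
  then show ?thesis
    by (subst AE_restrict_space_iff) (auto simp: F_def indicator_def elim: eventually_mono)
qed

lemma AE_zero_of_integrals_zero:
  fixes f :: "real \<Rightarrow> complex"
  assumes f: "f absolutely_integrable_on {0..l}" and zero: "\<And>x. x \<in> {0..l} \<Longrightarrow> integral {0..x} f = 0"
  shows "AE x in lebesgue_on {0<..<l}. f x = 0"
proof -
  have i: "f integrable_on {0..x}" if "x \<in> {0..l}" for x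
    using f that integrable_on_subinterval[of f "{0..l}" 0 x] by (auto simp: absolutely_integrable_on_def)
  have "AE x in lebesgue_on {0<..<l}. Re (f x) = 0"
  proof (rule AE_zero_of_integrals_zero_real)
    show "(\<lambda>x. Re (f x)) absolutely_integrable_on {0..l}"
      using absolutely_integrable_linear[OF f bounded_linear_Re] by (simp add: o_def)
    show "integral {0..x} (\<lambda>x. Re (f x)) = 0" if "x \<in> {0..l}" for x
      using integral_linear[OF i[OF that] bounded_linear_Re] zero[OF that] by (simp add: o_def)
  qed
  moreover have "AE x in lebesgue_on {0<..<l}. Im (f x) = 0"
  proof (rule AE_zero_of_integrals_zero_real)
    show "(\<lambda>x. Im (f x)) absolutely_integrable_on {0..l}"
      using absolutely_integrable_linear[OF f bounded_linear_Im] by (simp add: o_def)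
    show "integral {0..x} (\<lambda>x. Im (f x)) = 0" if "x \<in> {0..l}" for x
      using integral_linear[OF i[OF that] bounded_linear_Im] zero[OF that] by (simp add: o_def)
  qed
  ultimately show ?thesis by eventually_elim (simp add: complex_eq_iff)
qed

section \<open>The fundamental lemma of the calculus of variations\<close>

text \<open>
  For small \<open>\<delta>\<close> this is a continuous piecewise linear approximation of the indicator of \<open>[a, b]\<close>. Its
  antiderivative below uses that \<open>x \<bar>x\<bar> / 2\<close> is an antiderivative of \<open>\<bar>x\<bar>\<close>.
\<close>

definition plateau :: "real \<Rightarrow> real \<Rightarrow> real \<Rightarrow> real \<Rightarrow> real" where
  "plateau \<delta> a b x = (\<bar>x - a + \<delta>\<bar> - \<bar>x - a - \<delta>\<bar> - \<bar>x - b + \<delta>\<bar> + \<bar>x - b - \<delta>\<bar>) / (4 * \<delta>)"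


definition plateau_integral :: "real \<Rightarrow> real \<Rightarrow> real \<Rightarrow> real \<Rightarrow> real" where
  "plateau_integral \<delta> a b x = ((x - a + \<delta>) * \<bar>x - a + \<delta>\<bar> - (x - a - \<delta>) * \<bar>x - a - \<delta>\<bar>
      - (x - b + \<delta>) * \<bar>x - b + \<delta>\<bar> + (x - b - \<delta>) * \<bar>x - b - \<delta>\<bar>) / (8 * \<delta>)"

lemma has_real_derivative_mult_abs: "((\<lambda>x. x * \<bar>x\<bar>) has_real_derivative 2 * \<bar>x\<bar>) (at x)"
proof (cases "x = 0")
  case True
  have "((\<lambda>h::real. \<bar>h\<bar>) \<longlongrightarrow> 0) (at 0)"
    using tendsto_rabs_zero[OF tendsto_ident_at] by simp
  then have "((\<lambda>h::real. (h * \<bar>h\<bar>) / h) \<longlongrightarrow> 0) (at 0)"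
    by (rule Lim_transform_eventually) (auto simp: eventually_at_filter)
  then show ?thesis using True by (simp add: has_field_derivative_iff)
next
  case False
  have "((\<lambda>y. sgn x * y\<^sup>2) has_real_derivative sgn x * (2 * x)) (at x)"
    by (auto intro!: derivative_eq_intros)
  then have "((\<lambda>y. y * \<bar>y\<bar>) has_real_derivative sgn x * (2 * x)) (at x)"
    \<comment> \<open>On this ball the sign is that of \<open>x\<close>.\<close>
    by (rule has_field_derivative_transform_within_open[where S="ball x \<bar>x\<bar>"])
      (use False in \<open>auto simp: sgn_if dist_real_def abs_if power2_eq_square split: if_splits\<close>)
  moreover have "sgn x * (2 * x) = 2 * \<bar>x\<bar>" by (simp add: sgn_if)
  ultimately show ?thesis by simp
qed

lemma has_real_derivative_plateau_integral:
  assumes "\<delta> > 0"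
  shows "(plateau_integral \<delta> a b has_real_derivative plateau \<delta> a b x) (at x)"
proof -
  have *: "((\<lambda>x. (x + c) * \<bar>x + c\<bar>) has_real_derivative 2 * \<bar>x + c\<bar>) (at x)" for c
    using DERIV_shift[of "\<lambda>x. x * \<bar>x\<bar>" "2 * \<bar>x + c\<bar>" x c] has_real_derivative_mult_abs[of "x + c"] by simp
  have "((\<lambda>x. ((x + (\<delta> - a)) * \<bar>x + (\<delta> - a)\<bar> - (x + (-a-\<delta>)) * \<bar>x + (-a-\<delta>)\<bar>
      - (x + (\<delta>-b)) * \<bar>x + (\<delta>-b)\<bar> + (x + (-b - \<delta>)) * \<bar>x + (-b-\<delta>)\<bar>) / (8 * \<delta>)) has_real_derivative
     (2 * \<bar>x + (\<delta> - a)\<bar> - 2 * \<bar>x + (-a-\<delta>)\<bar> - 2 * \<bar>x + (\<delta>-b)\<bar> + 2 * \<bar>x + (-b-\<delta>)\<bar>) / (8 * \<delta>)) (at x)"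
    by (intro DERIV_cdivide DERIV_add DERIV_diff *)
  moreover have "plateau \<delta> a b x =
     (2 * \<bar>x + (\<delta> - a)\<bar> - 2 * \<bar>x + (-a-\<delta>)\<bar> - 2 * \<bar>x + (\<delta>-b)\<bar> + 2 * \<bar>x + (-b-\<delta>)\<bar>) / (8 * \<delta>)"
    using assms by (simp add: plateau_def algebra_simps divide_simps)
  moreover have "plateau_integral \<delta> a b = (\<lambda>x. ((x + (\<delta> - a)) * \<bar>x + (\<delta> - a)\<bar> - (x + (-a-\<delta>)) * \<bar>x + (-a-\<delta>)\<bar>
      - (x + (\<delta>-b)) * \<bar>x + (\<delta>-b)\<bar> + (x + (-b - \<delta>)) * \<bar>x + (-b-\<delta>)\<bar>) / (8 * \<delta>))"
    by (simp add: plateau_integral_def fun_eq_iff algebra_simps)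
  ultimately show ?thesis by simp
qed

lemma plateau_integral_left:
  assumes "\<delta> > 0" "a < b" "x \<le> a - \<delta>"
  shows "plateau_integral \<delta> a b x = - (b - a) / 2"
proof -
  have "\<bar>x - a + \<delta>\<bar> = -(x - a + \<delta>)" "\<bar>x - a - \<delta>\<bar> = -(x - a - \<delta>)"
      "\<bar>x - b + \<delta>\<bar> = -(x - b + \<delta>)" "\<bar>x - b - \<delta>\<bar> = -(x - b - \<delta>)"
    using assms by auto
  then show ?thesis
    using assms(1) unfolding plateau_integral_def by (simp add: field_simps)
qed

lemma plateau_integral_right:
  assumes "\<delta> > 0" "a < b" "b + \<delta> \<le> x"
  shows "plateau_integral \<delta> a b x = (b - a) / 2"
proof -
  have "\<bar>x - a + \<delta>\<bar> = (x - a + \<delta>)" "\<bar>x - a - \<delta>\<bar> = (x - a - \<delta>)"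
      "\<bar>x - b + \<delta>\<bar> = (x - b + \<delta>)" "\<bar>x - b - \<delta>\<bar> = (x - b - \<delta>)"
    using assms by auto
  then show ?thesis
    using assms(1) unfolding plateau_integral_def by (simp add: field_simps)
qed

text \<open>Each of the two differences of absolute values is at most \<open>2 * \<delta>\<close> in
  size. The bound is uniform in \<delta> and provides the majorant for dominated
  convergence.\<close>

lemma abs_plateau_le_1:
  assumes "\<delta> > 0"
  shows "\<bar>plateau \<delta> a b x\<bar> \<le> 1"
proof -
  have "\<bar>(\<bar>x - a + \<delta>\<bar> - \<bar>x - a - \<delta>\<bar> - \<bar>x - b + \<delta>\<bar> + \<bar>x - b - \<delta>\<bar>)\<bar> \<le> 4 * \<delta>"
    using assms by arith
  then show ?thesis using assms by (simp add: plateau_def divide_simps)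
qed

text \<open>Each ramp equals its limit as soon as \<delta> is below the distance of \<open>x\<close>
  to the corner. The limit is written with \<open>sgn\<close> because at the corners
  \<open>a < b\<close> it is 1/2 and not a value of the indicator.\<close>

lemma plateau_tendsto:
  "(\<lambda>n. plateau (inverse (real (Suc n))) a b x) \<longlonglongrightarrow> (sgn (x - a) - sgn (x - b)) / 2"
proof -
  have ramp: "eventually (\<lambda>\<delta>. (\<bar>y + \<delta>\<bar> - \<bar>y - \<delta>\<bar>) / (4 * \<delta>) = sgn y / 2) (at_right 0)" for y :: real
  proof (cases "y = 0")
    case True then show ?thesis by simp
  next
    case False
    then have "eventually (\<lambda>\<delta>. 0 < \<delta> \<and> \<delta> < \<bar>y\<bar>) (at_right 0)"
      by (auto simp: eventually_at_right_field intro!: exI[of _ "\<bar>y\<bar>"])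
    then show ?thesis
      by eventually_elim (auto simp: sgn_if divide_simps)
  qed
  have "eventually (\<lambda>\<delta>. plateau \<delta> a b x = (sgn (x - a) - sgn (x - b)) / 2) (at_right 0)"
    using ramp[of "x - a"] ramp[of "x - b"]
    by eventually_elim (simp add: plateau_def add_divide_distrib diff_divide_distrib algebra_simps)
  moreover have "filterlim (\<lambda>n. inverse (real (Suc n))) (at_right 0) sequentially"
    unfolding filterlim_at using LIMSEQ_inverse_real_of_nat by (auto simp del: of_nat_Suc)
  ultimately have "eventually (\<lambda>n. plateau (inverse (real (Suc n))) a b x = (sgn (x - a) - sgn (x - b)) / 2) sequentially"
    by (rule eventually_compose_filterlim)
  then show ?thesis
    by (simp add: tendsto_eventually)
qed

text \<open>The antiderivative of a plateau is normalised to be opposite on the two sides, so after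
  division by the length it is -1/2 on the left and 1/2 on the right for every plateau. The
  difference of two of them therefore has compact support, and \<delta> is small enough to keep it
  inside the open interval.\<close>

lemma plateau_difference_test_function:
  assumes "0 < a" "a < b" "b < l" "0 < c" "c < d" "d < l"
    and \<delta>: "0 < \<delta>" "\<delta> < a" "\<delta> < c" "\<delta> < l - b" "\<delta> < l - d"
  defines "\<phi> \<equiv> \<lambda>x. plateau_integral \<delta> a b x / (b - a) - plateau_integral \<delta> c d x / (d - c)"
  shows "\<phi> \<in> test_functions l"
    and "deriv \<phi> x = plateau \<delta> a b x / (b - a) - plateau \<delta> c d x / (d - c)"
proof -
  have D: "(\<phi> has_real_derivative plateau \<delta> a b x / (b - a) - plateau \<delta> c d x / (d - c)) (at x)" for x
    unfolding \<phi>_def by (intro DERIV_diff DERIV_cdivide has_real_derivative_plateau_integral \<delta>)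
  then show "deriv \<phi> x = plateau \<delta> a b x / (b - a) - plateau \<delta> c d x / (d - c)"
    by (rule DERIV_imp_deriv)
  have "\<phi> C1_differentiable_on UNIV"
    unfolding C1_differentiable_on_def
  proof (intro exI conjI ballI)
    show "(\<phi> has_vector_derivative plateau \<delta> a b x / (b - a) - plateau \<delta> c d x / (d - c)) (at x)" for x
      using D has_real_derivative_iff_has_vector_derivative by blast
    show "continuous_on UNIV (\<lambda>x. plateau \<delta> a b x / (b - a) - plateau \<delta> c d x / (d - c))"
      unfolding plateau_def using assms by (intro continuous_intros) auto
  qed
  moreover have "closure {x. \<phi> x \<noteq> 0} \<subseteq> {0<..<l}"
  proof -
    let ?I = "{min a c - \<delta>..max b d + \<delta>}"
    have "{x. \<phi> x \<noteq> 0} \<subseteq> ?I"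
    proof (rule ccontr)
      assume "\<not> ?thesis"
      then obtain x where x: "\<phi> x \<noteq> 0" "x \<notin> ?I" by blast
      \<comment> \<open>Outside \<open>?I\<close> the point lies on the same side of both plateaus,
        where the two normalised antiderivatives coincide.\<close>
      then consider "x \<le> a - \<delta>" "x \<le> c - \<delta>" | "b + \<delta> \<le> x" "d + \<delta> \<le> x" by fastforce
      then show False
        using x(1) assms(1-6) \<delta>
        by cases (simp_all add: \<phi>_def plateau_integral_left plateau_integral_right field_simps)
    qed
    then have "closure {x. \<phi> x \<noteq> 0} \<subseteq> ?I"
      by (rule closure_minimal) auto
    also have "?I \<subseteq> {0<..<l}" using assms by auto
    finally show ?thesis .
  qed
  ultimately show "\<phi> \<in> test_functions l" by (simp add: test_functions_def)
qed

lemma integral_plateau_tendsto: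
  fixes h :: "real \<Rightarrow> complex"
  assumes h: "h absolutely_integrable_on {0..l}" and "0 < a" "a < b" "b < l"
  shows "(\<lambda>n. \<integral>x. h x * of_real (plateau (inverse (real (Suc n))) a b x) \<partial>lebesgue_on {0<..<l})
    \<longlonglongrightarrow> integral {a..b} h"
proof -
  let ?M = "lebesgue_on {0<..<l}"
  let ?lim = "\<lambda>x. h x * of_real ((sgn (x - a) - sgn (x - b)) / 2)"
  have hi: "integrable ?M h" using h by (simp add: integrable_lebesgue_on_Ioo_iff)
  then have hm [measurable]: "h \<in> borel_measurable ?M" by auto
  have pm [measurable]: "plateau \<delta> a b \<in> borel_measurable ?M" for \<delta>
    by (rule borel_measurable_lebesgue_on) (simp add: plateau_def[abs_def])
  have sm [measurable]: "(\<lambda>x. (sgn (x - a) - sgn (x - b)) / 2) \<in> borel_measurable ?M"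
    by (rule borel_measurable_lebesgue_on) simp
  have "(\<lambda>n. \<integral>x. h x * of_real (plateau (inverse (real (Suc n))) a b x) \<partial>?M) \<longlonglongrightarrow> (\<integral>x. ?lim x \<partial>?M)"
  proof (rule integral_dominated_convergence[where w="\<lambda>x. norm (h x)"])
    show "AE x in ?M. (\<lambda>n. h x * of_real (plateau (inverse (real (Suc n))) a b x)) \<longlonglongrightarrow> ?lim x"
      by (intro AE_I2 tendsto_intros plateau_tendsto)
    show "AE x in ?M. norm (h x * of_real (plateau (inverse (real (Suc n))) a b x)) \<le> norm (h x)" for n
      using abs_plateau_le_1[of "inverse (real (Suc n))" a b]
      by (intro AE_I2) (simp add: norm_mult mult_left_le)
  qed (use hi in \<open>measurable, auto\<close>)
  also have "(\<integral>x. ?lim x \<partial>?M) = integral {a..b} h"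
  proof -
    have li: "integrable ?M ?lim"
      by (rule Bochner_Integration.integrable_bound[OF hi])
        (measurable, auto intro!: AE_I2 simp: norm_mult sgn_if)
    have "(\<integral>x. ?lim x \<partial>?M) = integral {0<..<l} ?lim"
      using li by (rule lebesgue_integral_eq_integral) simp
    \<comment> \<open>Only at \<open>a\<close> and \<open>b\<close>, where the limit is 1/2, does it
      differ from the indicator.\<close>
    also have "\<dots> = integral {0<..<l} (\<lambda>x. if x \<in> {a..b} then h x else 0)"
      by (rule integral_spike[where S="{a,b}"]) (use assms in \<open>auto simp: sgn_if\<close>)
    also have "\<dots> = integral {a..b} h"
    proof -
      have "{a..b} \<inter> {0<..<l} = {a..b}" using assms by auto
      then show ?thesis by (simp only: integral_restrict_Int)
    qed
    finally show ?thesis .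
  qed
  finally show ?thesis .
qed

text \<open>
  Testing with the difference of two normalised plateaus shows that the mean value of \<open>h\<close> is the same
  on all compact subintervals of \<open>(0, l)\<close>.
\<close>

lemma du_Bois_Reymond:
  fixes h :: "real \<Rightarrow> complex"
  assumes "0 < l" and h: "h absolutely_integrable_on {0..l}"
    and test: "\<And>\<phi>. \<phi> \<in> test_functions l \<Longrightarrow> (\<integral>x. h x * of_real (deriv \<phi> x) \<partial>lebesgue_on {0<..<l}) = 0"
  shows "\<exists>C. AE x in lebesgue_on {0<..<l}. h x = C"
proof -
  let ?M = "lebesgue_on {0<..<l}"
  have hi: "integrable ?M h" using h by (simp add: integrable_lebesgue_on_Ioo_iff)
  have hp: "integrable ?M (\<lambda>x. h x * of_real (plateau \<delta> a b x))" if "\<delta> > 0" for \<delta> a b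
  proof (rule Bochner_Integration.integrable_bound[OF hi])
    have [measurable]: "h \<in> borel_measurable ?M" using hi by auto
    have [measurable]: "plateau \<delta> a b \<in> borel_measurable ?M"
      by (rule borel_measurable_lebesgue_on) (simp add: plateau_def[abs_def])
    show "(\<lambda>x. h x * of_real (plateau \<delta> a b x)) \<in> borel_measurable ?M" by measurable
  qed (use abs_plateau_le_1[OF that] in \<open>auto intro!: AE_I2 simp: norm_mult mult_left_le\<close>)
  have mean: "integral {a..b} h / of_real (b - a) = integral {c..d} h / of_real (d - c)"
    if *: "0 < a" "a < b" "b < l" "0 < c" "c < d" "d < l" for a b c d
  proof -
    let ?P = "\<lambda>a b n. \<integral>x. h x * of_real (plateau (inverse (real (Suc n))) a b x) \<partial>?M"
    have lim: "(\<lambda>n. ?P a b n / of_real (b - a)) \<longlonglongrightarrow> integral {a..b} h / of_real (b - a)"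
         "(\<lambda>n. ?P c d n / of_real (d - c)) \<longlonglongrightarrow> integral {c..d} h / of_real (d - c)"
      using * by (intro tendsto_divide tendsto_const integral_plateau_tendsto[OF h]; simp)+
    \<comment> \<open>These four distances to the ends of the interval are what an admissible
      \<delta> must stay below.\<close>
    have "eventually (\<lambda>n. inverse (real (Suc n)) < Min {a, c, l - b, l - d}) sequentially"
      by (rule order_tendstoD(2)[OF LIMSEQ_inverse_real_of_nat]) (use * in auto)
    then have "eventually (\<lambda>n. ?P a b n / of_real (b - a) = ?P c d n / of_real (d - c)) sequentially"
    proof eventually_elim
      case (elim n)
      let ?\<delta> = "inverse (real (Suc n))"
      have pos: "0 < ?\<delta>" by simp
      let ?\<phi> = "\<lambda>x. plateau_integral ?\<delta> a b x / (b - a) - plateau_integral ?\<delta> c d x / (d - c)"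
      have small: "?\<delta> < a" "?\<delta> < c" "?\<delta> < l - b" "?\<delta> < l - d" using elim by auto
      have "0 = (\<integral>x. h x * of_real (deriv ?\<phi> x) \<partial>?M)"
        using test[OF plateau_difference_test_function(1)[OF * pos small]] by simp
      also have "\<dots> = (\<integral>x. h x * of_real (plateau ?\<delta> a b x) / of_real (b - a)
            - h x * of_real (plateau ?\<delta> c d x) / of_real (d - c) \<partial>?M)"
        unfolding plateau_difference_test_function(2)[OF * pos small]
        by (intro Bochner_Integration.integral_cong) (auto simp: right_diff_distrib)
      also have "\<dots> = ?P a b n / of_real (b - a) - ?P c d n / of_real (d - c)"
        using hp[OF pos] by (subst Bochner_Integration.integral_diff) auto
      finally show ?case by simp
    qed
    then have "(\<lambda>n. ?P a b n / of_real (b - a)) \<longlonglongrightarrow> integral {c..d} h / of_real (d - c)"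
      using lim(2) by (simp add: tendsto_cong)
    then show ?thesis using lim(1) LIMSEQ_unique by blast
  qed
  \<comment> \<open>The common mean value, read off from the middle third as a reference
    interval.\<close>
  define C where "C = integral {l/3..2*l/3} h / of_real (2*l/3 - l/3)"
  have C: "integral {a..b} h = C * of_real (b - a)" if "0 < a" "a < b" "b < l" for a b
    using mean[OF that, of "l/3" "2*l/3"] that \<open>0 < l\<close> by (simp add: C_def field_simps)
  define K where "K = (\<lambda>x. integral {0..x} h - C * of_real x)"
  have H: "abs_cont l (\<lambda>x. integral {0..x} h) h" by (rule abs_cont_of_integral[OF h])
  have Kcont: "continuous_on {0..l} K"
    unfolding K_def by (intro continuous_intros abs_cont_continuous[OF H])
  have Kmid: "K x = K (l/2)" if "x \<in> {0<..<l}" for x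
  proof -
    have *: "K s = K t" if st: "0 < s" "s < t" "t < l" for s t
    proof -
      have "integral {s..t} h = integral {0..t} h - integral {0..s} h"
        by (rule integral_unique, rule abs_cont_has_integral[OF H]) (use st in simp_all)
      then have "integral {0..t} h - integral {0..s} h = C * of_real t - C * of_real s"
        using C[OF st] by (simp add: right_diff_distrib)
      moreover have "a - b = c - d \<Longrightarrow> b - d = a - c" for a b c d :: complex
        by (simp add: algebra_simps)
      ultimately show ?thesis unfolding K_def by blast
    qed
    consider "x < l/2" | "x = l/2" | "l/2 < x" by linarith
    then show ?thesis
    proof cases
      case 1 then show ?thesis by (intro *) (use that \<open>0 < l\<close> in auto)
    next
      case 2 then show ?thesis by (simp only:)
    next
      case 3 then show ?thesis by (intro *[symmetric]) (use that \<open>0 < l\<close> in auto)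
    qed
  qed
  define k where "k = K (l/2)"
  \<comment> \<open>Mean values are controlled only strictly inside the interval; continuity of
    \<open>K\<close> carries constancy to the closed interval, and \<open>K 0 = 0\<close> fixes the
    constant.\<close>
  have K0: "K x = k" if "x \<in> {0..l}" for x
  proof (rule continuous_constant_on_closure[of "{0<..<l}" K])
    show "K y = k" if "y \<in> {0<..<l}" for y
      using Kmid[OF that] by (simp only: k_def)
  qed (use Kcont that \<open>0 < l\<close> in auto)
  have "k = 0" using K0[of 0] \<open>0 < l\<close> by (simp add: K_def)
  then have "integral {0..x} h = C * of_real x" if "x \<in> {0..l}" for x
    using K0[OF that] by (simp add: K_def)
  moreover have "(\<lambda>x. h x - C) absolutely_integrable_on {0..l}"
    by (intro set_integral_diff h absolutely_integrable_continuous_real continuous_intros)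
  moreover have "integral {0..x} (\<lambda>x. h x - C) = integral {0..x} h - C * of_real x" if "x \<in> {0..l}" for x
  proof -
    have "h integrable_on {0..x}"
      using h that integrable_on_subinterval[of h "{0..l}" 0 x] by (auto simp: absolutely_integrable_on_def)
    then show ?thesis
      using that Henstock_Kurzweil_Integration.integral_diff[of h "{0..x}" "\<lambda>_. C"] integrable_const_ivl[of C 0 x]
      by (simp add: scaleR_conv_of_real mult.commute)
  qed
  ultimately have "AE x in ?M. h x - C = 0"
    by (intro AE_zero_of_integrals_zero) simp_all
  then show ?thesis by (intro exI[of _ C]) simp
qed

section \<open>Weak derivatives and indefinite integrals\<close>

lemma L2_absolutely_integrable:
  assumes "f \<in> L2 l"
  shows "f absolutely_integrable_on {0..l}"
proof -
  let ?M = "lebesgue_on {0<..<l}"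
  have fin: "finite_measure ?M"
    by (rule finite_measureI) (cases "0 \<le> l"; simp add: emeasure_restrict_space)
  have f: "f \<in> borel_measurable ?M" "integrable ?M (\<lambda>x. (cmod (f x))\<^sup>2)"
    using assms by (auto simp: L2_def)
  have "integrable ?M (\<lambda>x. 1 + (cmod (f x))\<^sup>2)"
    using f(2) finite_measure.integrable_const[OF fin] by (intro Bochner_Integration.integrable_add)
  then have "integrable ?M f"
  proof (rule Bochner_Integration.integrable_bound[OF _ f(1)])
    show "AE x in ?M. norm (f x) \<le> norm (1 + (cmod (f x))\<^sup>2)"
    proof (intro AE_I2)
      fix x
      have "0 \<le> (cmod (f x) - 1)\<^sup>2" by simp
      then show "norm (f x) \<le> norm (1 + (cmod (f x))\<^sup>2)"
        by (simp add: power2_diff) (use norm_ge_zero[of "f x"] in linarith)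
    qed
  qed
  then show ?thesis by (simp add: integrable_lebesgue_on_Ioo_iff)
qed

text \<open>Makes polynomials, and products of continuous factors on a closed edge, available as
  elements of \<open>L2\<close>.\<close>

lemma L2_continuous:
  assumes "continuous_on {0..l} f"
  shows "f \<in> L2 l"
proof -
  have "(\<lambda>x. (cmod (f x))\<^sup>2) absolutely_integrable_on {0..l}"
    by (intro absolutely_integrable_continuous_real continuous_intros assms)
  moreover have "f absolutely_integrable_on {0..l}"
    by (intro absolutely_integrable_continuous_real assms)
  ultimately show ?thesis
    by (auto simp: L2_def simp flip: integrable_lebesgue_on_Ioo_iff)
qed

lemma L2_diff:
  assumes "f \<in> L2 l" "g \<in> L2 l"
  shows "(\<lambda>x. f x - g x) \<in> L2 l"
proof -
  let ?M = "lebesgue_on {0<..<l}"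
  have fg: "f \<in> borel_measurable ?M" "integrable ?M (\<lambda>x. (cmod (f x))\<^sup>2)"
    "g \<in> borel_measurable ?M" "integrable ?M (\<lambda>x. (cmod (g x))\<^sup>2)"
    using assms by (auto simp: L2_def)
  have "integrable ?M (\<lambda>x. (cmod (f x - g x))\<^sup>2)"
  proof (rule Bochner_Integration.integrable_bound)
    show "integrable ?M (\<lambda>x. 2 * (cmod (f x))\<^sup>2 + 2 * (cmod (g x))\<^sup>2)"
      using fg by auto
    show "(\<lambda>x. (cmod (f x - g x))\<^sup>2) \<in> borel_measurable ?M"
      using fg(1,3) by measurable
    show "AE x in ?M. norm ((cmod (f x - g x))\<^sup>2) \<le> norm (2 * (cmod (f x))\<^sup>2 + 2 * (cmod (g x))\<^sup>2)"
    proof (intro AE_I2)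
      fix x
      have "(cmod (f x - g x))\<^sup>2 \<le> (cmod (f x) + cmod (g x))\<^sup>2"
        by (intro power_mono norm_triangle_ineq4) simp
      also have "\<dots> \<le> 2 * (cmod (f x))\<^sup>2 + 2 * (cmod (g x))\<^sup>2"
        using zero_le_power2[of "cmod (f x) - cmod (g x)"] by (simp add: power2_diff power2_sum)
      finally show "norm ((cmod (f x - g x))\<^sup>2) \<le> norm (2 * (cmod (f x))\<^sup>2 + 2 * (cmod (g x))\<^sup>2)"
        by simp
    qed
  qed
  then show ?thesis using fg by (simp add: L2_def)
qed

lemma test_function_deriv:
  assumes "\<phi> \<in> test_functions l"
  shows "(\<phi> has_real_derivative deriv \<phi> x) (at x)" "continuous_on S (deriv \<phi>)"
proof -
  obtain D where D: "\<And>x. (\<phi> has_vector_derivative D x) (at x)" "continuous_on UNIV D"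
    using assms by (auto simp: test_functions_def C1_differentiable_on_def)
  have "deriv \<phi> = D"
    using D(1) by (auto simp: fun_eq_iff has_real_derivative_iff_has_vector_derivative intro!: DERIV_imp_deriv)
  then show "(\<phi> has_real_derivative deriv \<phi> x) (at x)" "continuous_on S (deriv \<phi>)"
    using D by (auto simp: has_real_derivative_iff_has_vector_derivative intro: continuous_on_subset)
qed

lemma test_function_abs_cont:
  assumes "\<phi> \<in> test_functions l"
  shows "abs_cont l (\<lambda>x. of_real (\<phi> x)) (\<lambda>x. of_real (deriv \<phi> x))" and "\<phi> 0 = 0" and "\<phi> l = 0"
proof -
  have supp: "closure {x. \<phi> x \<noteq> 0} \<subseteq> {0<..<l}"
    using assms by (auto simp: test_functions_def)
  show "abs_cont l (\<lambda>x. of_real (\<phi> x)) (\<lambda>x. of_real (deriv \<phi> x))"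
  proof (rule abs_cont_of_deriv)
    show "((\<lambda>x. complex_of_real (\<phi> x)) has_vector_derivative of_real (deriv \<phi> x)) (at x within {0..l})" for x
      by (rule has_vector_derivative_of_real[OF has_field_derivative_at_within[OF test_function_deriv(1)[OF assms]]])
    show "continuous_on {0..l} (\<lambda>x. complex_of_real (deriv \<phi> x))"
      by (rule continuous_on_of_real[OF test_function_deriv(2)[OF assms]])
  qed
  have "{x. \<phi> x \<noteq> 0} \<subseteq> {0<..<l}" by (rule order_trans[OF closure_subset supp])
  then show "\<phi> 0 = 0" "\<phi> l = 0" by auto
qed

text \<open>Integration by parts: the product rule is applied to \<open>F\<close> and a test
  function, which vanishes at both ends.\<close>

lemma abs_cont_has_weak_deriv:
  assumes F: "abs_cont l F f" and "0 < l"
  shows "has_weak_deriv l F f"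
  unfolding has_weak_deriv_def
proof
  fix \<phi> assume "\<phi> \<in> test_functions l"
  note \<phi> = test_function_abs_cont[OF this]
  have c: "continuous_on {0..l} (\<lambda>x. complex_of_real (\<phi> x))" "continuous_on {0..l} F"
    by (rule abs_cont_continuous[OF \<phi>(1)], rule abs_cont_continuous[OF F])
  have i: "(\<lambda>x. f x * of_real (\<phi> x)) absolutely_integrable_on {0..l}"
     "(\<lambda>x. of_real (deriv \<phi> x) * F x) absolutely_integrable_on {0..l}"
    by (intro absolutely_integrable_mult_continuous abs_cont_integrable[OF F] abs_cont_integrable[OF \<phi>(1)] c)+
  have "((\<lambda>x. f x * of_real (\<phi> x) + of_real (deriv \<phi> x) * F x) has_integral 0) {0..l}"
    using abs_cont_has_integral[OF abs_cont_mult[OF F \<phi>(1)], of 0 l] \<open>0 < l\<close> \<phi>(2,3) by simp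
  then have "integral {0..l} (\<lambda>x. f x * of_real (\<phi> x)) + integral {0..l} (\<lambda>x. of_real (deriv \<phi> x) * F x) = 0"
    using i Henstock_Kurzweil_Integration.integral_add[of "\<lambda>x. f x * of_real (\<phi> x)" "{0..l}" "\<lambda>x. of_real (deriv \<phi> x) * F x"]
    by (simp add: absolutely_integrable_on_def integral_unique)
  then show "(\<integral>x. F x * of_real (deriv \<phi> x) \<partial>lebesgue_on {0<..<l}) = - (\<integral>x. f x * of_real (\<phi> x) \<partial>lebesgue_on {0<..<l})"
    using integral_lebesgue_on_Ioo[OF i(1)] integral_lebesgue_on_Ioo[OF i(2)]
    by (simp add: mult.commute add_eq_0_iff)
qed

text \<open>The difference of \<open>f\<close> and the indefinite integral of \<open>g\<close> has
  weak derivative zero, so it is almost everywhere a constant, which is absorbed into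
  \<open>F\<close>.\<close>

lemma weak_deriv_imp_abs_cont:
  assumes "0 < l" and f: "f absolutely_integrable_on {0..l}" and g: "g absolutely_integrable_on {0..l}"
    and fg: "has_weak_deriv l f g"
  shows "\<exists>F. abs_cont l F g \<and> (AE x in lebesgue_on {0<..<l}. f x = F x)"
proof -
  let ?M = "lebesgue_on {0<..<l}" and ?G = "\<lambda>x. integral {0..x} g"
  have G: "abs_cont l ?G g" by (rule abs_cont_of_integral[OF g])
  have Gi: "?G absolutely_integrable_on {0..l}"
    by (intro absolutely_integrable_continuous_real abs_cont_continuous[OF G])
  have "\<exists>C. AE x in ?M. f x - ?G x = C"
  proof (rule du_Bois_Reymond[OF \<open>0 < l\<close>])
    show "(\<lambda>x. f x - ?G x) absolutely_integrable_on {0..l}"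
      by (intro set_integral_diff f Gi)
    fix \<phi> assume \<phi>: "\<phi> \<in> test_functions l"
    have "continuous_on {0..l} (\<lambda>x. complex_of_real (deriv \<phi> x))"
      by (intro continuous_intros test_function_deriv[OF \<phi>])
    then have "integrable ?M (\<lambda>x. f x * of_real (deriv \<phi> x))" "integrable ?M (\<lambda>x. ?G x * of_real (deriv \<phi> x))"
      by (auto simp: integrable_lebesgue_on_Ioo_iff intro!: absolutely_integrable_mult_continuous f Gi)
    then have "(\<integral>x. (f x - ?G x) * of_real (deriv \<phi> x) \<partial>?M) =
        (\<integral>x. f x * of_real (deriv \<phi> x) \<partial>?M) - (\<integral>x. ?G x * of_real (deriv \<phi> x) \<partial>?M)"
      by (simp add: left_diff_distrib)
    also have "\<dots> = 0"
      using fg abs_cont_has_weak_deriv[OF G \<open>0 < l\<close>] \<phi> by (simp add: has_weak_deriv_def)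
    finally show "(\<integral>x. (f x - ?G x) * of_real (deriv \<phi> x) \<partial>?M) = 0" .
  qed
  then obtain C where "AE x in ?M. f x - ?G x = C" ..
  then have "AE x in ?M. f x = ?G x + C" by eventually_elim (simp add: algebra_simps)
  moreover have "abs_cont l (\<lambda>x. ?G x + C) g"
    using G by (simp add: abs_cont_def)
  ultimately show ?thesis by blast
qed

lemma AE_eq_imp_eq_continuous:
  fixes f g :: "real \<Rightarrow> complex"
  assumes "0 < l" "continuous_on {0..l} f" "continuous_on {0..l} g" "AE x in lebesgue_on {0<..<l}. f x = g x"
    and "x \<in> {0..l}"
  shows "f x = g x"
proof -
  let ?h = "\<lambda>x. norm (f x - g x)"
  have c: "continuous_on {0..l} ?h" using assms by (intro continuous_intros)
  then have i: "?h absolutely_integrable_on {0..l}" by (rule absolutely_integrable_continuous_real)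
  have "integral {0..l} ?h = (\<integral>x. ?h x \<partial>lebesgue_on {0<..<l})"
    using integral_lebesgue_on_Ioo[OF i] by simp
  also have "\<dots> = 0"
    by (rule integral_eq_zero_AE) (use assms(4) in \<open>auto elim: eventually_mono\<close>)
  finally have "\<forall>x\<in>{0..l}. ?h x = 0"
    using c \<open>0 < l\<close> by (subst (asm) integral_eq_0_iff) auto
  then show ?thesis using assms(5) by simp
qed

text \<open>The indefinite integrals of \<open>g\<close> and \<open>h\<close> that represent
  \<open>f\<close> agree almost everywhere, hence everywhere by continuity, so all integrals of
  \<open>g - h\<close> from 0 vanish. This makes statements about the choice in
  \<open>weak_deriv\<close> independent of it up to null sets.\<close>

lemma weak_deriv_unique:
  assumes "0 < l" and "g \<in> L2 l" "h \<in> L2 l" and "f \<in> L2 l"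
    and "has_weak_deriv l f g" "has_weak_deriv l f h"
  shows "AE x in lebesgue_on {0<..<l}. g x = h x"
proof -
  note ai = L2_absolutely_integrable
  obtain F1 F2 where F: "abs_cont l F1 g" "AE x in lebesgue_on {0<..<l}. f x = F1 x"
      "abs_cont l F2 h" "AE x in lebesgue_on {0<..<l}. f x = F2 x"
    using weak_deriv_imp_abs_cont[OF assms(1) ai[OF assms(4)] ai[OF assms(2)] assms(5)]
      weak_deriv_imp_abs_cont[OF assms(1) ai[OF assms(4)] ai[OF assms(3)] assms(6)] by blast
  have "AE x in lebesgue_on {0<..<l}. F1 x = F2 x"
    using F(2,4) by eventually_elim simp
  then have eq: "F1 x = F2 x" if "x \<in> {0..l}" for x
    by (rule AE_eq_imp_eq_continuous[OF \<open>0 < l\<close> abs_cont_continuous[OF F(1)] abs_cont_continuous[OF F(3)] _ that])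
  have "AE x in lebesgue_on {0<..<l}. g x - h x = 0"
  proof (rule AE_zero_of_integrals_zero)
    show "(\<lambda>x. g x - h x) absolutely_integrable_on {0..l}"
      by (rule set_integral_diff(1)[OF ai[OF assms(2)] ai[OF assms(3)]])
    fix x assume x: "x \<in> {0..l}"
    have "(g has_integral F1 x - F1 0) {0..x}" "(h has_integral F2 x - F2 0) {0..x}"
      using F(1,3) x by (auto simp: abs_cont_def)
    then have "((\<lambda>x. g x - h x) has_integral (F1 x - F1 0) - (F2 x - F2 0)) {0..x}"
      by (rule has_integral_diff)
    then show "integral {0..x} (\<lambda>x. g x - h x) = 0"
      using eq[OF x] eq[of 0] \<open>0 < l\<close> by (auto dest!: integral_unique)
  qed
  then show ?thesis by simp
qed

lemma H1_weak_deriv: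
  assumes "f \<in> H1 l"
  shows "weak_deriv l f \<in> L2 l" "has_weak_deriv l f (weak_deriv l f)"
proof -
  have "\<exists>g. g \<in> L2 l \<and> has_weak_deriv l f g" using assms by (auto simp: H1_def)
  then have "weak_deriv l f \<in> L2 l \<and> has_weak_deriv l f (weak_deriv l f)"
    unfolding weak_deriv_def by (rule someI_ex)
  then show "weak_deriv l f \<in> L2 l" "has_weak_deriv l f (weak_deriv l f)" by auto
qed

lemma weak_deriv_AE:
  assumes "0 < l" "f \<in> L2 l" "g \<in> L2 l" "has_weak_deriv l f g"
  shows "f \<in> H1 l" "AE x in lebesgue_on {0<..<l}. weak_deriv l f x = g x"
proof -
  show H: "f \<in> H1 l" using assms by (auto simp: H1_def)
  show "AE x in lebesgue_on {0<..<l}. weak_deriv l f x = g x"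
    using weak_deriv_unique[OF assms(1) H1_weak_deriv(1)[OF H] assms(3,2) H1_weak_deriv(2)[OF H] assms(4)] .
qed

text \<open>Continuity up to the ends upgrades the almost-everywhere representation to all of
  \<open>{0..l}\<close>. This is how elements of \<open>H1_graph\<close> acquire the product rule
  and their boundary values.\<close>

lemma H1_continuous_abs_cont:
  assumes "0 < l" "f \<in> H1 l" "continuous_on {0..l} f"
  shows "abs_cont l f (weak_deriv l f)"
proof -
  note w = H1_weak_deriv[OF assms(2)]
  obtain F where F: "abs_cont l F (weak_deriv l f)" "AE x in lebesgue_on {0<..<l}. f x = F x"
    using weak_deriv_imp_abs_cont[OF assms(1) _ _ w(2)] L2_absolutely_integrable w(1) assms(2)
    by (auto simp: H1_def)
  have eq: "f x = F x" if "x \<in> {0..l}" for x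
    using AE_eq_imp_eq_continuous[OF assms(1,3) abs_cont_continuous[OF F(1)] F(2) that] .
  then show ?thesis using F(1) \<open>0 < l\<close> by (auto simp: abs_cont_def)
qed

lemma abs_cont_cong_AE:
  assumes F: "abs_cont l F f" and ae: "AE x in lebesgue_on {0<..<l}. f x = g x"
    and g: "g absolutely_integrable_on {0..l}"
  shows "abs_cont l F g"
  unfolding abs_cont_def
proof (intro conjI ballI g)
  fix x assume x: "x \<in> {0..l}"
  have "AE x in lebesgue. x \<in> {0<..<l} \<longrightarrow> f x = g x"
    using ae by (simp add: AE_restrict_space_iff)
  then obtain N where N: "\<And>x. x \<in> {0<..<l} - N \<Longrightarrow> f x = g x" "N \<in> null_sets lebesgue"
    by (elim AE_E3) (rule that, auto)
  show "(g has_integral F x - F 0) {0..x}"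
  proof (rule has_integral_spike)
    \<comment> \<open>The endpoints join the exceptional set because the hypothesis only speaks
      about the open interval.\<close>
    show "negligible (N \<union> {0, l})"
      using N(2) by (auto simp: negligible_iff_null_sets)
    show "(f has_integral F x - F 0) {0..x}" using F x by (simp add: abs_cont_def)
    fix t assume "t \<in> {0..x} - (N \<union> {0, l})"
    then show "g t = f t" using x by (intro N(1)[symmetric]) auto
  qed
qed

text \<open>Used for second derivatives: \<open>weak_deriv l f\<close> is known only almost
  everywhere, yet it has to be differentiated weakly again.\<close>

lemma has_weak_deriv_cong_AE:
  assumes "f \<in> borel_measurable (lebesgue_on {0<..<l})" "f' \<in> borel_measurable (lebesgue_on {0<..<l})"
    and "AE x in lebesgue_on {0<..<l}. f x = f' x" and "has_weak_deriv l f g"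
  shows "has_weak_deriv l f' g"
  unfolding has_weak_deriv_def
proof
  fix \<phi> assume \<phi>: "\<phi> \<in> test_functions l"
  have "continuous_on UNIV (deriv \<phi>)"
    by (rule test_function_deriv[OF \<phi>])
  then have [measurable]: "deriv \<phi> \<in> borel_measurable (lebesgue_on {0<..<l})"
    by (intro borel_measurable_lebesgue_on borel_measurable_continuous_onI)
  note [measurable] = assms(1,2)
  have "(\<integral>x. f' x * of_real (deriv \<phi> x) \<partial>lebesgue_on {0<..<l}) = (\<integral>x. f x * of_real (deriv \<phi> x) \<partial>lebesgue_on {0<..<l})"
    by (rule integral_cong_AE) (measurable, use assms(3) in \<open>auto elim: eventually_mono\<close>)
  then show "(\<integral>x. f' x * of_real (deriv \<phi> x) \<partial>lebesgue_on {0<..<l}) = - (\<integral>x. g x * of_real (\<phi> x) \<partial>lebesgue_on {0<..<l})"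
    using assms(4) \<phi> by (simp add: has_weak_deriv_def)
qed

section \<open>Functions with constant second derivative\<close>

lemma quadratic_abs_cont:
  fixes p c k :: complex
  shows "abs_cont l (\<lambda>x. p + c * of_real x + k * (of_real x)\<^sup>2 / 2) (\<lambda>x. c + k * of_real x)"
  by (rule abs_cont_of_deriv)
    (auto intro!: derivative_eq_intros continuous_intros simp: has_vector_derivative_def scaleR_conv_of_real algebra_simps fun_eq_iff)

lemma quadratic_weak_deriv:
  fixes p c k :: complex
  assumes "0 < l" and f: "\<And>x. x \<in> {0..l} \<Longrightarrow> f x = p + c * of_real x + k * (of_real x)\<^sup>2 / 2"
  shows "f \<in> H2 l" "AE x in lebesgue_on {0<..<l}. weak_deriv l f x = c + k * of_real x"
    "AE x in lebesgue_on {0<..<l}. weak_deriv l (weak_deriv l f) x = k"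
proof -
  have 1: "abs_cont l f (\<lambda>x. c + k * of_real x)"
    using quadratic_abs_cont[of l p c k] f \<open>0 < l\<close> by (simp add: abs_cont_def)
  have 2: "abs_cont l (\<lambda>x. c + k * of_real x) (\<lambda>x. k)"
    using quadratic_abs_cont[of l c k 0] by simp
  have H: "f \<in> H1 l" and ae: "AE x in lebesgue_on {0<..<l}. weak_deriv l f x = c + k * of_real x"
    using weak_deriv_AE[OF \<open>0 < l\<close> L2_continuous[OF abs_cont_continuous[OF 1]] L2_continuous[OF abs_cont_continuous[OF 2]]
        abs_cont_has_weak_deriv[OF 1 \<open>0 < l\<close>]] by auto
  show "AE x in lebesgue_on {0<..<l}. weak_deriv l f x = c + k * of_real x" by (fact ae)
  let ?g = "weak_deriv l f"
  have g: "?g \<in> L2 l" using H1_weak_deriv(1)[OF H] .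
  have "has_weak_deriv l ?g (\<lambda>x. k)"
  proof (rule has_weak_deriv_cong_AE)
    show "has_weak_deriv l (\<lambda>x. c + k * of_real x) (\<lambda>x. k)"
      by (rule abs_cont_has_weak_deriv[OF 2 \<open>0 < l\<close>])
    show "(\<lambda>x. c + k * of_real x) \<in> borel_measurable (lebesgue_on {0<..<l})"
      "?g \<in> borel_measurable (lebesgue_on {0<..<l})"
      using L2_continuous[OF abs_cont_continuous[OF 2]] g by (auto simp: L2_def)
    show "AE x in lebesgue_on {0<..<l}. c + k * of_real x = ?g x"
      using ae by eventually_elim simp
  qed
  then have "?g \<in> H1 l" "AE x in lebesgue_on {0<..<l}. weak_deriv l ?g x = k"
    using weak_deriv_AE[OF \<open>0 < l\<close> g L2_continuous[of l "\<lambda>x. k"]] by auto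
  then show "f \<in> H2 l" "AE x in lebesgue_on {0<..<l}. weak_deriv l ?g x = k"
    using H by (auto simp: H2_def)
qed

text \<open>Integrating twice: the first weak derivative has a continuous representative with
  constant derivative, hence an affine one, whose value at 0 is the slope \<open>c\<close>.\<close>

lemma quadratic_of_weak_deriv:
  fixes k :: complex
  assumes "0 < l" "f \<in> H2 l" "continuous_on {0..l} f"
    and ae: "AE x in lebesgue_on {0<..<l}. weak_deriv l (weak_deriv l f) x = k"
  shows "\<exists>c. \<forall>x\<in>{0..l}. f x = f 0 + c * of_real x + k * (of_real x)\<^sup>2 / 2"
proof -
  let ?g = "weak_deriv l f" let ?h = "weak_deriv l ?g"
  have f: "f \<in> H1 l" and g: "?g \<in> H1 l" using assms(2) by (auto simp: H2_def)
  note ai = L2_absolutely_integrable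
  obtain F where F: "abs_cont l F ?h" "AE x in lebesgue_on {0<..<l}. ?g x = F x"
    using weak_deriv_imp_abs_cont[OF assms(1) _ _ H1_weak_deriv(2)[OF g]] H1_weak_deriv(1)[OF g] g
    by (auto simp: H1_def ai)
  have Fk: "abs_cont l F (\<lambda>x. k)"
    by (rule abs_cont_cong_AE[OF F(1) ae]) (auto intro!: absolutely_integrable_continuous_real)
  have Fx: "F x = F 0 + k * of_real x" if "x \<in> {0..l}" for x
  proof -
    have "((\<lambda>x. k) has_integral of_real x * k) {0..x}"
      using has_integral_const_real[of k 0 x] that by (simp add: scaleR_conv_of_real)
    then have "F x - F 0 = of_real x * k"
      using Fk that by (auto simp: abs_cont_def intro: has_integral_unique)
    then have "F x = of_real x * k + F 0" by (simp only: diff_eq_eq)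
    then show ?thesis by (simp only: add.commute mult.commute)
  qed
  have *: "abs_cont l f (\<lambda>x. F 0 + k * of_real x)"
  proof (rule abs_cont_cong_AE[OF H1_continuous_abs_cont[OF assms(1) f assms(3)]])
    have "AE x in lebesgue_on {0<..<l}. F x = F 0 + k * of_real x"
      by (rule AE_I2, rule Fx) simp
    with F(2) show "AE x in lebesgue_on {0<..<l}. ?g x = F 0 + k * of_real x"
      by eventually_elim simp
  qed (intro absolutely_integrable_continuous_real continuous_intros)
  have eq: "f x - f 0 = (f 0 + F 0 * of_real x + k * (of_real x)\<^sup>2 / 2) - f 0" if "x \<in> {0..l}" for x
  proof (rule has_integral_unique)
    show "((\<lambda>x. F 0 + k * of_real x) has_integral f x - f 0) {0..x}"
      using that * by (simp add: abs_cont_def)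
    show "((\<lambda>x. F 0 + k * of_real x) has_integral (f 0 + F 0 * of_real x + k * (of_real x)\<^sup>2 / 2) - f 0) {0..x}"
      using that quadratic_abs_cont[of l "f 0" "F 0" k] by (simp add: abs_cont_def)
  qed
  show ?thesis
  proof (intro exI ballI)
    fix x assume "x \<in> {0..l}"
    from eq[OF this] show "f x = f 0 + F 0 * of_real x + k * (of_real x)\<^sup>2 / 2"
      by (simp only: diff_eq_eq diff_add_cancel)
  qed
qed

section \<open>The torsion function\<close>

text \<open>An injective square system is solvable. Numbering the finite set \<open>V\<close> turns
  the system into one with a matrix, and injectivity says that its determinant does not
  vanish.\<close>

lemma linear_system_solvable:
  fixes A :: "'v \<Rightarrow> 'v \<Rightarrow> real" and b :: "'v \<Rightarrow> real"
  assumes "finite V"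
    and inj: "\<And>x. \<forall>i\<in>V. (\<Sum>j\<in>V. A i j * x j) = 0 \<Longrightarrow> \<forall>j\<in>V. x j = 0"
  shows "\<exists>x. \<forall>i\<in>V. (\<Sum>j\<in>V. A i j * x j) = b i"
proof -
  define n where "n = card V"
  obtain h where h: "bij_betw h {0..<n} V"
    using ex_bij_betw_nat_finite[OF \<open>finite V\<close>] n_def by blast
  define k where "k = the_inv_into {0..<n} h"
  have kh: "k (h i) = i" if "i < n" for i
    unfolding k_def using h that by (intro the_inv_into_f_f) (auto simp: bij_betw_def)
  have hV: "h i \<in> V" if "i < n" for i
    using h that by (auto simp: bij_betw_def)
  have Vh: "\<exists>i<n. v = h i" if "v \<in> V" for v
    using h that by (auto simp: bij_betw_def)
  have reindex: "(\<Sum>j\<in>V. A i j * x (k j)) = (\<Sum>j\<in>{0..<n}. A i (h j) * x j)" for i and x :: "nat \<Rightarrow> real"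
    by (subst sum.reindex_bij_betw[OF h, symmetric]) (auto intro!: sum.cong simp: kh)
  define M where "M = mat n n (\<lambda>(i, j). A (h i) (h j))"
  have M: "M \<in> carrier_mat n n" by (simp add: M_def)
  have Mv: "vec_index (M *\<^sub>v v) i = (\<Sum>j\<in>V. A (h i) j * vec_index v (k j))" if "v \<in> carrier_vec n" "i < n" for v i
    using that by (simp add: M_def scalar_prod_def reindex)
  have "Determinant.det M \<noteq> 0"
  proof
    assume "Determinant.det M = 0"
    then obtain v where v: "v \<in> carrier_vec n" "v \<noteq> 0\<^sub>v n" "M *\<^sub>v v = 0\<^sub>v n"
      using det_0_iff_vec_prod_zero[OF M] by blast
    have "\<forall>i\<in>V. (\<Sum>j\<in>V. A i j * vec_index v (k j)) = 0"
    proof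
      fix i assume "i \<in> V"
      then obtain i' where "i' < n" "i = h i'" using Vh by blast
      then show "(\<Sum>j\<in>V. A i j * vec_index v (k j)) = 0"
        using Mv[OF v(1), of i'] v(3) by simp
    qed
    then have "\<forall>j\<in>V. vec_index v (k j) = 0" by (rule inj)
    then have "vec_index v i = 0" if "i < n" for i
      using hV[OF that] kh[OF that] by force
    then have "v = 0\<^sub>v n"
      using v(1) by (intro eq_vecI) auto
    then show False using v(2) by simp
  qed
  define w where "w = Matrix.vec n (\<lambda>i. b (h i))"
  \<comment> \<open>Cramer's rule: the adjugate divided by the determinant inverts
    \<open>M\<close>.\<close>
  define x where "x = (1 / Determinant.det M) \<cdot>\<^sub>v (adj_mat M *\<^sub>v w)"
  have w: "w \<in> carrier_vec n" by (simp add: w_def)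
  have adj: "adj_mat M \<in> carrier_mat n n" "M * adj_mat M = Determinant.det M \<cdot>\<^sub>m 1\<^sub>m n" using adj_mat[OF M] by auto
  have x: "x \<in> carrier_vec n" using adj w by (simp add: x_def)
  have "M *\<^sub>v x = (1 / Determinant.det M) \<cdot>\<^sub>v (M *\<^sub>v (adj_mat M *\<^sub>v w))"
    unfolding x_def using M adj(1) w by (simp add: mult_mat_vec)
  also have "M *\<^sub>v (adj_mat M *\<^sub>v w) = (M * adj_mat M) *\<^sub>v w"
    using M adj(1) w by (simp add: assoc_mult_mat_vec)
  also have "\<dots> = Determinant.det M \<cdot>\<^sub>v w"
    unfolding adj(2) using w by (intro eq_vecI) auto
  finally have "M *\<^sub>v x = w"
    using \<open>Determinant.det M \<noteq> 0\<close> by (simp add: smult_smult_assoc)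
  show ?thesis
  proof (intro exI[of _ "\<lambda>j. vec_index x (k j)"] ballI)
    fix i assume "i \<in> V"
    then obtain i' where i': "i' < n" "i = h i'" using Vh by blast
    then show "(\<Sum>j\<in>V. A i j * vec_index x (k j)) = b i"
      using Mv[OF x, of i'] \<open>M *\<^sub>v x = w\<close> by (simp add: w_def)
  qed
qed

section \<open>Topology of the glued graph and sums over edge ends\<close>

context metric_graph
begin

lemma topspace_edge_space: "topspace (edge_space G len) = Sigma (arcs G) (\<lambda>e. {0..len e})"
  by (auto simp: edge_space_def)

text \<open>Isolated vertices would not be images of an edge point; \<open>verts_incident\<close>
  excludes them.\<close>

lemma topspace_graph:
  "topspace (graph_space G len) =
    Vertex ` verts G \<union> {Interior e x | e x. e \<in> arcs G \<and> 0 < x \<and> x < len e}" (is "?L = ?R")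
proof
  show "?L \<subseteq> ?R"
    by (auto simp: topspace_graph_space topspace_edge_space glue_def split: if_splits)
  show "?R \<subseteq> ?L"
  proof
    fix p assume "p \<in> ?R"
    then consider v where "p = Vertex v" "v \<in> verts G"
      | e x where "p = Interior e x" "e \<in> arcs G" "0 < x" "x < len e" by auto
    then show "p \<in> ?L"
    proof cases
      case 1
      then obtain e where e: "e \<in> arcs G" "tail G e = v \<or> head G e = v"
        using verts_incident by blast
      then have "p = glue G len (e, 0) \<or> p = glue G len (e, len e)"
        using 1 length_pos[OF e(1)] by (auto simp: glue_def)
      then show ?thesis
        using e length_pos[OF e(1)] by (auto simp: topspace_graph_space topspace_edge_space)
    next
      case 2
      then have "p = glue G len (e, x)" by (simp add: glue_def)
      then show ?thesis using 2 by (auto simp: topspace_graph_space topspace_edge_space)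
    qed
  qed
qed

lemma glue_in_topspace:
  "e \<in> arcs G \<Longrightarrow> x \<in> {0..len e} \<Longrightarrow> glue G len (e, x) \<in> topspace (graph_space G len)"
  by (auto simp: topspace_graph_space topspace_edge_space)

lemma topspace_graph_cases:
  assumes "p \<in> topspace (graph_space G len)"
  obtains e x where "e \<in> arcs G" "x \<in> {0..len e}" "p = glue G len (e, x)"
  using assms by (auto simp: topspace_graph_space topspace_edge_space)

lemma restrict_edge_ends:
  assumes "e \<in> arcs G"
  shows "restrict_edge G len u e 0 = u (Vertex (tail G e))"
    and "restrict_edge G len u e (len e) = u (Vertex (head G e))"
  using length_pos[OF assms] by (auto simp: restrict_edge_def glue_def)

text \<open>The universal property of the quotient, followed by that of the disjoint sum. Continuity
  at a vertex is already encoded in \<open>u\<close> having a single value at the glued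
  point.\<close>

lemma continuous_map_graph_space_iff:
  fixes u :: "('v, 'e) point \<Rightarrow> 'c::topological_space"
  shows "continuous_map (graph_space G len) euclidean u \<longleftrightarrow>
    (\<forall>e\<in>arcs G. continuous_on {0..len e} (restrict_edge G len u e))"
proof -
  have "continuous_map (graph_space G len) euclidean u \<longleftrightarrow>
      continuous_map (edge_space G len) euclidean (u \<circ> glue G len)"
    by (rule continuous_compose_quotient_map_eq[OF quotient_map_glue, symmetric])
  also have "\<dots> \<longleftrightarrow> (\<forall>e\<in>arcs G. continuous_map (top_of_set {0..len e}) euclidean (restrict_edge G len u e))"
    (is "?L \<longleftrightarrow> ?R")
  proof
    assume L: ?L
    show ?R
    proof
      fix e assume "e \<in> arcs G"
      then have "continuous_map (top_of_set {0..len e}) (edge_space G len) (\<lambda>x. (e, x))"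
        unfolding edge_space_def by (rule continuous_map_component_injection)
      from continuous_map_compose[OF this L]
      show "continuous_map (top_of_set {0..len e}) euclidean (restrict_edge G len u e)"
        by (simp add: o_def restrict_edge_def[abs_def])
    qed
  next
    assume R: ?R
    show ?L
      unfolding continuous_map_def
    proof (intro conjI allI impI)
      fix U :: "'c set" assume U: "openin euclidean U"
      have "{x. (e, x) \<in> {p \<in> topspace (edge_space G len). (u \<circ> glue G len) p \<in> U}} =
          {x \<in> topspace (top_of_set {0..len e}). restrict_edge G len u e x \<in> U}" if "e \<in> arcs G" for e
        using that by (auto simp: topspace_edge_space restrict_edge_def)
      moreover have "openin (top_of_set {0..len e}) {x \<in> topspace (top_of_set {0..len e}). restrict_edge G len u e x \<in> U}"
        if "e \<in> arcs G" for e
        using R that U unfolding continuous_map_def by blast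
      ultimately show "openin (edge_space G len) {p \<in> topspace (edge_space G len). (u \<circ> glue G len) p \<in> U}"
        by (auto simp: edge_space_def openin_sum_topology)
    qed auto
  qed
  finally show ?thesis by simp
qed

text \<open>Every arc has exactly one tail. With \<open>sum_head\<close> this exchanges sums over
  vertices and over edges in the two summations by parts below.\<close>

lemma sum_tail: "(\<Sum>v\<in>verts G. \<Sum>e | e \<in> arcs G \<and> tail G e = v. f v e) = (\<Sum>e\<in>arcs G. f (tail G e) e)"
proof -
  have "(\<Sum>v\<in>verts G. \<Sum>e | e \<in> arcs G \<and> tail G e = v. f v e) =
      (\<Sum>v\<in>verts G. \<Sum>e | e \<in> arcs G \<and> tail G e = v. f (tail G e) e)"
    by (intro sum.cong) auto
  also have "\<dots> = (\<Sum>e\<in>arcs G. f (tail G e) e)"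
    by (rule sum.group) auto
  finally show ?thesis .
qed

lemma sum_head: "(\<Sum>v\<in>verts G. \<Sum>e | e \<in> arcs G \<and> head G e = v. f v e) = (\<Sum>e\<in>arcs G. f (head G e) e)"
proof -
  have "(\<Sum>v\<in>verts G. \<Sum>e | e \<in> arcs G \<and> head G e = v. f v e) =
      (\<Sum>v\<in>verts G. \<Sum>e | e \<in> arcs G \<and> head G e = v. f (head G e) e)"
    by (intro sum.cong) auto
  also have "\<dots> = (\<Sum>e\<in>arcs G. f (head G e) e)"
    by (rule sum.group) auto
  finally show ?thesis .
qed

text \<open>A loop occurs in both sums; its two ends are different pairs because its length is not
  0.\<close>

lemma sum_edge_ends:
  "(\<Sum>p\<in>edge_ends G len v. F p) =
    (\<Sum>e | e \<in> arcs G \<and> tail G e = v. F (e, 0)) + (\<Sum>e | e \<in> arcs G \<and> head G e = v. F (e, len e))"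
proof -
  let ?O = "{e \<in> arcs G. tail G e = v}" and ?I = "{e \<in> arcs G. head G e = v}"
  have "edge_ends G len v = (\<lambda>e. (e, 0)) ` ?O \<union> (\<lambda>e. (e, len e)) ` ?I"
    by (auto simp: edge_ends_def)
  moreover have "(\<lambda>e. (e, 0)) ` ?O \<inter> (\<lambda>e. (e, len e)) ` ?I = {}"
    using length_pos by force
  ultimately have "sum F (edge_ends G len v) = sum F ((\<lambda>e. (e, 0)) ` ?O) + sum F ((\<lambda>e. (e, len e)) ` ?I)"
    by (simp add: sum.union_disjoint)
  also have "\<dots> = (\<Sum>e\<in>?O. F (e, 0)) + (\<Sum>e\<in>?I. F (e, len e))"
    by (simp add: sum.reindex inj_on_def)
  finally show ?thesis .
qed

text \<open>The edges on which \<open>f\<close> takes the value \<open>f v\<close> at their ends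
  form a set \<open>S\<close> that is open and closed in the graph, since its preimage in each edge
  is either the whole edge or empty.\<close>

lemma constant_on_verts:
  assumes "path_connected_space (graph_space G len)"
    and f: "\<And>e. e \<in> arcs G \<Longrightarrow> f (tail G e) = f (head G e)"
    and "v \<in> verts G" "w \<in> verts G"
  shows "f v = f w"
proof (rule ccontr)
  assume "f v \<noteq> f w"
  define S where "S = {p \<in> topspace (graph_space G len).
    case p of Vertex z \<Rightarrow> f z = f v | Interior e x \<Rightarrow> f (tail G e) = f v}"
  \<comment> \<open>The flag \<open>b\<close> selects \<open>S\<close> or its complement, so that a
    single argument shows both to be open.\<close>
  have preimage: "{x. (e, x) \<in> {p \<in> topspace (edge_space G len). glue G len p \<in> T}} =
      (if (f (tail G e) = f v) = b then {0..len e} else {})"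
    if e: "e \<in> arcs G" and T: "T = S \<and> b \<or> T = topspace (graph_space G len) - S \<and> \<not> b" for e T b
  proof -
    have "glue G len (e, x) \<in> S \<longleftrightarrow> f (tail G e) = f v" if "x \<in> {0..len e}" for x
      using glue_in_topspace[OF e that] f[OF e] by (simp add: S_def glue_def)
    then show ?thesis
      using glue_in_topspace[OF e] e T by (auto simp: topspace_edge_space)
  qed
  have "openin (graph_space G len) T" if "T = S \<and> b \<or> T = topspace (graph_space G len) - S \<and> \<not> b" for T b
    unfolding openin_graph_space
  proof
    show "T \<subseteq> glue G len ` topspace (edge_space G len)"
      using that by (auto simp: S_def topspace_graph_space)
    show "openin (edge_space G len) {p \<in> topspace (edge_space G len). glue G len p \<in> T}"
      unfolding edge_space_def openin_sum_topology
      using preimage[OF _ that] by (auto simp: edge_space_def)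
  qed
  from this[of S True] this[of "topspace (graph_space G len) - S" False]
  have "openin (graph_space G len) S" "closedin (graph_space G len) S"
    by (auto simp: closedin_def S_def)
  moreover have "connected_space (graph_space G len)"
    using assms(1) by (rule path_connected_imp_connected_space)
  ultimately have "S = {} \<or> S = topspace (graph_space G len)"
    by (simp add: connected_space_clopen_in)
  moreover have "Vertex v \<in> S" "Vertex w \<notin> S" "Vertex w \<in> topspace (graph_space G len)"
    using assms(3,4) \<open>f v \<noteq> f w\<close> by (auto simp: S_def topspace_graph)
  ultimately show False by auto
qed

section \<open>The linear system for the vertex values\<close>

text \<open>
  If \<open>u'' = -1\<close> on every edge, the vertex condition at \<open>v\<close> says that \<open>vertex_operator\<close>, applied to the
  vertex values of \<open>u\<close>, equals \<open>vertex_load\<close> at \<open>v\<close>.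
\<close>

definition vertex_operator :: "('v \<Rightarrow> real) \<Rightarrow> ('v \<Rightarrow> real) \<Rightarrow> 'v \<Rightarrow> real" where
  "vertex_operator \<alpha> x v =
     (\<Sum>e | e \<in> arcs G \<and> tail G e = v. (x v - x (head G e)) / len e) +
     (\<Sum>e | e \<in> arcs G \<and> head G e = v. (x v - x (tail G e)) / len e) + \<alpha> v * x v"

definition vertex_load :: "'v \<Rightarrow> real" where
  "vertex_load v = (\<Sum>e | e \<in> arcs G \<and> tail G e = v. len e / 2) + (\<Sum>e | e \<in> arcs G \<and> head G e = v. len e / 2)"

text \<open>Strict positivity, which rests on every vertex having an edge, is the source of
  strictness in the minimum principle.\<close>

lemma vertex_load_pos:
  assumes "v \<in> verts G"
  shows "0 < vertex_load v"
proof -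
  have pos: "0 < len e / 2" if "e \<in> arcs G" for e using length_pos[OF that] by simp
  obtain e where e: "e \<in> arcs G" "tail G e = v \<or> head G e = v" using verts_incident[OF assms] by blast
  then show ?thesis
  proof (elim disjE)
    assume "tail G e = v"
    then have "0 < (\<Sum>e | e \<in> arcs G \<and> tail G e = v. len e / 2)"
      using e pos by (intro sum_pos2[of _ e]) (auto intro: less_imp_le)
    moreover have "0 \<le> (\<Sum>e | e \<in> arcs G \<and> head G e = v. len e / 2)"
      using pos by (intro sum_nonneg) (auto intro: less_imp_le)
    ultimately show ?thesis by (simp add: vertex_load_def)
  next
    assume "head G e = v"
    then have "0 < (\<Sum>e | e \<in> arcs G \<and> head G e = v. len e / 2)"
      using e pos by (intro sum_pos2[of _ e]) (auto intro: less_imp_le)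
    moreover have "0 \<le> (\<Sum>e | e \<in> arcs G \<and> tail G e = v. len e / 2)"
      using pos by (intro sum_nonneg) (auto intro: less_imp_le)
    ultimately show ?thesis by (simp add: vertex_load_def)
  qed
qed

lemma vertex_operator_diff:
  "vertex_operator \<alpha> (\<lambda>v. x v - y v) v = vertex_operator \<alpha> x v - vertex_operator \<alpha> y v"
  by (simp add: vertex_operator_def algebra_simps diff_divide_distrib add_divide_distrib sum.distrib sum_subtractf)

text \<open>The column of \<open>A\<close> at \<open>w\<close> is the operator applied to the
  indicator of \<open>w\<close>; \<open>?d\<close> is the Kronecker symbol.\<close>

lemma vertex_operator_matrix:
  "\<exists>A. \<forall>x. \<forall>v\<in>verts G. vertex_operator \<alpha> x v = (\<Sum>w\<in>verts G. A v w * x w)"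
proof -
  let ?d = "\<lambda>v w. if w = v then 1 else (0::real)"
  define A where "A v w = (\<Sum>e | e \<in> arcs G \<and> tail G e = v. (?d v w - ?d (head G e) w) / len e) +
     (\<Sum>e | e \<in> arcs G \<and> head G e = v. (?d v w - ?d (tail G e) w) / len e) + \<alpha> v * ?d v w" for v w
  have pick: "(\<Sum>w\<in>verts G. ?d v w * x w) = x v" if "v \<in> verts G" for v and x :: "'v \<Rightarrow> real"
    using that by (simp add: if_distrib[of "\<lambda>c. c * _"] cong: if_cong)
  have part: "(\<Sum>w\<in>verts G. (\<Sum>e\<in>E. (?d v w - ?d (t e) w) / len e) * x w) = (\<Sum>e\<in>E. (x v - x (t e)) / len e)"
    if "v \<in> verts G" "\<And>e. e \<in> E \<Longrightarrow> t e \<in> verts G" for v E t and x :: "'v \<Rightarrow> real"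
  proof -
    have "(\<Sum>w\<in>verts G. (\<Sum>e\<in>E. (?d v w - ?d (t e) w) / len e) * x w) =
        (\<Sum>e\<in>E. \<Sum>w\<in>verts G. (?d v w - ?d (t e) w) / len e * x w)"
      unfolding sum_distrib_right by (rule sum.swap)
    also have "\<dots> = (\<Sum>e\<in>E. ((\<Sum>w\<in>verts G. ?d v w * x w) - (\<Sum>w\<in>verts G. ?d (t e) w * x w)) / len e)"
      by (intro sum.cong refl)
        (simp only: sum_subtractf[symmetric] sum_divide_distrib left_diff_distrib times_divide_eq_left)
    also have "\<dots> = (\<Sum>e\<in>E. (x v - x (t e)) / len e)"
      using that by (intro sum.cong refl) (simp only: pick)
    finally show ?thesis .
  qed
  have "vertex_operator \<alpha> x v = (\<Sum>w\<in>verts G. A v w * x w)" if v: "v \<in> verts G" for x v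
  proof -
    have "(\<Sum>w\<in>verts G. \<alpha> v * ?d v w * x w) = \<alpha> v * (\<Sum>w\<in>verts G. ?d v w * x w)"
      by (simp only: sum_distrib_left mult.assoc)
    then show ?thesis
      unfolding A_def distrib_right sum.distrib vertex_operator_def
      using part[OF v, of "{e \<in> arcs G. tail G e = v}" "head G" x]
        part[OF v, of "{e \<in> arcs G. head G e = v}" "tail G" x] pick[OF v, of x] by simp
  qed
  then show ?thesis by blast
qed

text \<open>Summation by parts: an edge is met once from its tail and once from its head, and the
  two contributions combine to a square. A loop contributes 0 to both sides.\<close>

lemma vertex_operator_energy:
  "(\<Sum>v\<in>verts G. x v * vertex_operator \<alpha> x v) =
    (\<Sum>e\<in>arcs G. (x (head G e) - x (tail G e))\<^sup>2 / len e) + (\<Sum>v\<in>verts G. \<alpha> v * (x v)\<^sup>2)"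
proof -
  have "(\<Sum>v\<in>verts G. x v * vertex_operator \<alpha> x v) =
      (\<Sum>v\<in>verts G. \<Sum>e | e \<in> arcs G \<and> tail G e = v. x v * ((x v - x (head G e)) / len e)) +
      (\<Sum>v\<in>verts G. \<Sum>e | e \<in> arcs G \<and> head G e = v. x v * ((x v - x (tail G e)) / len e)) +
      (\<Sum>v\<in>verts G. \<alpha> v * (x v)\<^sup>2)"
    by (simp only: vertex_operator_def distrib_left sum.distrib sum_distrib_left power2_eq_square mult.left_commute)
  also have "\<dots> = (\<Sum>e\<in>arcs G. x (tail G e) * ((x (tail G e) - x (head G e)) / len e) +
        x (head G e) * ((x (head G e) - x (tail G e)) / len e)) + (\<Sum>v\<in>verts G. \<alpha> v * (x v)\<^sup>2)"
    by (simp only: sum_tail[of "\<lambda>v e. x v * ((x v - x (head G e)) / len e)"]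
        sum_head[of "\<lambda>v e. x v * ((x v - x (tail G e)) / len e)"] sum.distrib)
  also have "(\<Sum>e\<in>arcs G. x (tail G e) * ((x (tail G e) - x (head G e)) / len e) +
        x (head G e) * ((x (head G e) - x (tail G e)) / len e)) =
        (\<Sum>e\<in>arcs G. (x (head G e) - x (tail G e))\<^sup>2 / len e)"
    by (intro sum.cong refl) (simp add: power2_eq_square field_simps add_divide_distrib[symmetric] diff_divide_distrib[symmetric])
  finally show ?thesis .
qed

end

locale robin_graph = metric_graph G len for G :: "('v, 'e) pre_digraph" and len +
  fixes \<alpha> :: "'v \<Rightarrow> real"
  assumes connected: "path_connected_space (graph_space G len)"
    and strength_nonneg: "v \<in> verts G \<Longrightarrow> 0 \<le> \<alpha> v"
    and strength_nontrivial: "\<exists>v\<in>verts G. 0 < \<alpha> v"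
begin

text \<open>Pairing a kernel element with itself gives energy zero. It is then constant along edges,
  hence on the connected graph, and it vanishes at a vertex of positive strength.\<close>

lemma vertex_operator_injective:
  assumes "\<And>v. v \<in> verts G \<Longrightarrow> vertex_operator \<alpha> x v = 0" and "v \<in> verts G"
  shows "x v = 0"
proof -
  have n1: "0 \<le> (x (head G e) - x (tail G e))\<^sup>2 / len e" if "e \<in> arcs G" for e
    using length_pos[OF that] by simp
  have n2: "0 \<le> \<alpha> v * (x v)\<^sup>2" if "v \<in> verts G" for v
    using strength_nonneg[OF that] by simp
  have "(\<Sum>e\<in>arcs G. (x (head G e) - x (tail G e))\<^sup>2 / len e) + (\<Sum>v\<in>verts G. \<alpha> v * (x v)\<^sup>2) = 0"
    using vertex_operator_energy[of x \<alpha>] assms(1) by simp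
  moreover have "0 \<le> (\<Sum>e\<in>arcs G. (x (head G e) - x (tail G e))\<^sup>2 / len e)" "0 \<le> (\<Sum>v\<in>verts G. \<alpha> v * (x v)\<^sup>2)"
    using n1 n2 by (auto intro: sum_nonneg)
  ultimately have "(\<Sum>e\<in>arcs G. (x (head G e) - x (tail G e))\<^sup>2 / len e) = 0" "(\<Sum>v\<in>verts G. \<alpha> v * (x v)\<^sup>2) = 0"
    by linarith+
  then have e0: "\<And>e. e \<in> arcs G \<Longrightarrow> (x (head G e) - x (tail G e))\<^sup>2 / len e = 0"
    and v0: "\<And>v. v \<in> verts G \<Longrightarrow> \<alpha> v * (x v)\<^sup>2 = 0"
    using n1 n2 by (simp_all add: sum_nonneg_eq_0_iff)
  have "x (tail G e) = x (head G e)" if "e \<in> arcs G" for e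
    using e0[OF that] length_pos[OF that] by simp
  moreover obtain w where w: "w \<in> verts G" "0 < \<alpha> w" using strength_nontrivial by blast
  ultimately have "x v = x w"
    using constant_on_verts[OF connected, of x v w] assms(2) by blast
  then show ?thesis using v0[OF w(1)] w(2) by simp
qed

lemma vertex_operator_solvable: "\<exists>x. \<forall>v\<in>verts G. vertex_operator \<alpha> x v = b v"
proof -
  obtain A where A: "\<And>x v. v \<in> verts G \<Longrightarrow> vertex_operator \<alpha> x v = (\<Sum>w\<in>verts G. A v w * x w)"
    using vertex_operator_matrix by blast
  have "\<exists>x. \<forall>v\<in>verts G. (\<Sum>w\<in>verts G. A v w * x w) = b v"
    by (rule linear_system_solvable) (use A vertex_operator_injective in auto)
  then show ?thesis using A by auto
qed

definition vertex_torsion :: "'v \<Rightarrow> real" where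
  "vertex_torsion = (SOME x. \<forall>v\<in>verts G. vertex_operator \<alpha> x v = vertex_load v)"

lemma vertex_torsion: "v \<in> verts G \<Longrightarrow> vertex_operator \<alpha> vertex_torsion v = vertex_load v"
  using someI_ex[OF vertex_operator_solvable[of vertex_load]] by (simp add: vertex_torsion_def)

text \<open>At a minimising vertex all differences are nonpositive, so the strength term alone has
  to balance the positive load.\<close>

lemma vertex_torsion_pos:
  assumes "v \<in> verts G"
  shows "0 < vertex_torsion v"
proof -
  let ?x = vertex_torsion
  have "finite (?x ` verts G)" "?x ` verts G \<noteq> {}" using assms by auto
  then obtain w where w: "w \<in> verts G" and min: "\<And>v. v \<in> verts G \<Longrightarrow> ?x w \<le> ?x v"
    using Min_in[of "?x ` verts G"] Min_le[of "?x ` verts G"] by (metis (no_types, lifting) image_iff)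
  have "(\<Sum>e | e \<in> arcs G \<and> tail G e = w. (?x w - ?x (head G e)) / len e) \<le> 0"
    "(\<Sum>e | e \<in> arcs G \<and> head G e = w. (?x w - ?x (tail G e)) / len e) \<le> 0"
    using min length_pos by (auto intro!: sum_nonpos divide_nonpos_pos)
  then have "0 < \<alpha> w * ?x w"
    using vertex_torsion[OF w] vertex_load_pos[OF w] by (simp add: vertex_operator_def)
  then have "0 < ?x w"
    using strength_nonneg[OF w] by (simp add: zero_less_mult_iff)
  then show ?thesis using min[OF assms] by linarith
qed

end

context metric_graph
begin

lemma normal_deriv_quadratic:
  assumes e: "e \<in> arcs G"
    and q: "\<And>t. t \<in> {0..len e} \<Longrightarrow> restrict_edge G len u e t = p + c * of_real t + k * (of_real t)\<^sup>2 / 2"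
  shows "normal_deriv G len u (e, 0) = - c"
    and "normal_deriv G len u (e, len e) = c + k * of_real (len e)"
proof -
  have d: "vector_derivative (restrict_edge G len u e) (at t within {0..len e}) = c + k * of_real t"
    if t: "t \<in> {0..len e}" for t
  proof -
    have "((\<lambda>t. p + c * of_real t + k * (of_real t)\<^sup>2 / 2) has_vector_derivative c + k * of_real t) (at t within {0..len e})"
      by (auto intro!: derivative_eq_intros simp: has_vector_derivative_def scaleR_conv_of_real algebra_simps fun_eq_iff)
    then have "(restrict_edge G len u e has_vector_derivative c + k * of_real t) (at t within {0..len e})"
      by (rule has_vector_derivative_transform[rotated 2]) (use t q in auto)
    then show ?thesis
      using vector_derivative_within_cbox[of 0 "len e" t] t length_pos[OF e] by (simp add: cbox_interval)
  qed
  show "normal_deriv G len u (e, 0) = - c" "normal_deriv G len u (e, len e) = c + k * of_real (len e)"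
    using d[of 0] d[of "len e"] length_pos[OF e] by (auto simp: normal_deriv_def)
qed

text \<open>The values at the two ends of an edge determine its slope \<open>c e\<close>, which
  eliminates the slopes from the vertex condition. All coefficients are real, so real and imaginary
  parts decouple; the load appears only in the former because the second derivative is -1.\<close>

lemma vertex_condition:
  assumes q: "\<And>e t. e \<in> arcs G \<Longrightarrow> t \<in> {0..len e} \<Longrightarrow>
      restrict_edge G len u e t = u (Vertex (tail G e)) + c e * of_real t + (- 1) * (of_real t)\<^sup>2 / 2"
    and v: "v \<in> verts G"
  shows "(\<Sum>p\<in>edge_ends G len v. normal_deriv G len u p) + of_real (\<alpha> v) * u (Vertex v) =
    Complex (vertex_operator \<alpha> (\<lambda>w. Re (u (Vertex w))) v - vertex_load v)
      (vertex_operator \<alpha> (\<lambda>w. Im (u (Vertex w))) v)"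
proof -
  have c: "c e = (u (Vertex (head G e)) - u (Vertex (tail G e))) / of_real (len e) + of_real (len e) / 2"
    if e: "e \<in> arcs G" for e
  proof -
    have "u (Vertex (head G e)) = u (Vertex (tail G e)) + c e * of_real (len e) + (- 1) * (of_real (len e))\<^sup>2 / 2"
      using q[OF e, of "len e"] restrict_edge_ends(2)[OF e, of u] length_pos[OF e] by simp
    then show ?thesis
      using length_pos[OF e] by (simp add: field_simps power2_eq_square)
  qed
  have n: "normal_deriv G len u (e, 0) =
      of_real (1 / len e) * (u (Vertex (tail G e)) - u (Vertex (head G e))) - of_real (len e / 2)"
    "normal_deriv G len u (e, len e) =
      of_real (1 / len e) * (u (Vertex (head G e)) - u (Vertex (tail G e))) - of_real (len e / 2)"
    if e: "e \<in> arcs G" for e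
    using normal_deriv_quadratic[OF e q[OF e]] c[OF e] length_pos[OF e] by (simp_all add: field_simps)
  have s: "(\<Sum>e | e \<in> arcs G \<and> tail G e = v. normal_deriv G len u (e, 0)) =
     (\<Sum>e | e \<in> arcs G \<and> tail G e = v. of_real (1 / len e) * (u (Vertex v) - u (Vertex (head G e))) - of_real (len e / 2))"
    "(\<Sum>e | e \<in> arcs G \<and> head G e = v. normal_deriv G len u (e, len e)) =
     (\<Sum>e | e \<in> arcs G \<and> head G e = v. of_real (1 / len e) * (u (Vertex v) - u (Vertex (tail G e))) - of_real (len e / 2))"
    by (intro sum.cong; auto simp: n)+
  show ?thesis
    unfolding sum_edge_ends s
    by (simp add: complex_eq_iff vertex_operator_def vertex_load_def sum_subtractf)
qed

end

section \<open>Construction and uniqueness of the torsion function\<close>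

context robin_graph
begin

text \<open>The derivative at 0 of the solution with prescribed end values: the slope of the chord
  plus that of the parabola \<open>t * (len e - t) / 2\<close>.\<close>

definition edge_slope :: "'e \<Rightarrow> real" where
  "edge_slope e = (vertex_torsion (head G e) - vertex_torsion (tail G e)) / len e + len e / 2"

definition edge_torsion :: "'e \<Rightarrow> real \<Rightarrow> real" where
  "edge_torsion e t = vertex_torsion (tail G e) + edge_slope e * t - t\<^sup>2 / 2"

text \<open>The zero values off the graph follow the convention of \<open>H1_graph\<close>, which is
  what makes uniqueness an equality of functions.\<close>

definition torsion :: "('v, 'e) point \<Rightarrow> complex" where
  "torsion p = (case p of
      Vertex v \<Rightarrow> if v \<in> verts G then of_real (vertex_torsion v) else 0
    | Interior e t \<Rightarrow> if e \<in> arcs G \<and> 0 < t \<and> t < len e then of_real (edge_torsion e t) else 0)"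

lemma edge_torsion_ends:
  assumes "e \<in> arcs G"
  shows "edge_torsion e 0 = vertex_torsion (tail G e)" "edge_torsion e (len e) = vertex_torsion (head G e)"
  using length_pos[OF assms] by (simp_all add: edge_torsion_def edge_slope_def field_simps power2_eq_square)

text \<open>By concavity: the function is the chord between two positive end values plus a parabola
  that is nonnegative on the edge. Multiplication by the length clears the denominators.\<close>

lemma edge_torsion_pos:
  assumes e: "e \<in> arcs G" and t: "t \<in> {0..len e}"
  shows "0 < edge_torsion e t"
proof -
  let ?l = "len e" and ?a = "vertex_torsion (tail G e)" and ?b = "vertex_torsion (head G e)"
  have l: "0 < ?l" and a: "0 < ?a" and b: "0 < ?b"
    using length_pos[OF e] vertex_torsion_pos e by auto
  have "edge_torsion e t * ?l = (?l - t) * ?a + t * ?b + t * (?l - t) * ?l / 2"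
    using l by (simp add: edge_torsion_def edge_slope_def field_simps power2_eq_square)
  also have "\<dots> > 0"
  proof -
    have "0 \<le> t * (?l - t) * ?l / 2" "0 \<le> t * ?b" "0 \<le> (?l - t) * ?a" using t l a b by auto
    moreover have "0 < t * ?b \<or> 0 < (?l - t) * ?a" using t l a b by (cases "t = 0") auto
    ultimately show ?thesis by linarith
  qed
  finally show ?thesis using l by (simp add: zero_less_mult_iff)
qed

lemma restrict_torsion:
  assumes e: "e \<in> arcs G" and t: "t \<in> {0..len e}"
  shows "restrict_edge G len torsion e t = of_real (edge_torsion e t)"
  using assms edge_torsion_ends[OF e]
  by (auto simp: restrict_edge_def glue_def torsion_def)

lemma restrict_torsion_quadratic:
  assumes "e \<in> arcs G" and "t \<in> {0..len e}"
  shows "restrict_edge G len torsion e t =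
    torsion (Vertex (tail G e)) + of_real (edge_slope e) * of_real t + (- 1) * (of_real t)\<^sup>2 / 2"
  using assms by (simp add: restrict_torsion) (simp add: edge_torsion_def torsion_def)

lemma restrict_multiple_of_torsion:
  assumes "e \<in> arcs G" and "t \<in> {0..len e}"
  shows "restrict_edge G len (\<lambda>p. c * torsion p) e t =
    c * torsion (Vertex (tail G e)) + (c * of_real (edge_slope e)) * of_real t + (- c) * (of_real t)\<^sup>2 / 2"
proof -
  have "restrict_edge G len (\<lambda>p. c * torsion p) e t = c * restrict_edge G len torsion e t"
    by (simp add: restrict_edge_def)
  then show ?thesis by (simp add: restrict_torsion_quadratic[OF assms] algebra_simps)
qed

lemma multiple_of_torsion_in_H1: "(\<lambda>p. c * torsion p) \<in> H1_graph G len"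
proof -
  let ?u = "\<lambda>p. c * torsion p"
  have "continuous_on {0..len e} (restrict_edge G len ?u e)" if e: "e \<in> arcs G" for e
  proof -
    have "continuous_on {0..len e} (\<lambda>t. c * complex_of_real (edge_torsion e t))"
      unfolding edge_torsion_def by (intro continuous_intros) auto
    then show ?thesis
      by (rule continuous_on_eq) (use restrict_torsion[OF e] in \<open>simp add: restrict_edge_def\<close>)
  qed
  moreover have "restrict_edge G len ?u e \<in> H1 (len e)" if e: "e \<in> arcs G" for e
    using quadratic_weak_deriv(1)[OF length_pos[OF e] restrict_multiple_of_torsion[OF e]] by (simp add: H2_def)
  moreover have "torsion p = 0" if "p \<notin> topspace (graph_space G len)" for p
    using that by (auto simp: torsion_def topspace_graph split: point.split)
  ultimately show ?thesis
    by (simp add: H1_graph_def continuous_map_graph_space_iff)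
qed

lemma torsion_in_H1: "torsion \<in> H1_graph G len"
  using multiple_of_torsion_in_H1[of 1] by simp

lemma torsion_is_solution:
  "torsion \<in> laplacian_domain G len \<alpha>"
  "e \<in> arcs G \<Longrightarrow> AE x in lebesgue_on {0<..<len e}. neg_laplacian G len torsion e x = 1"
proof -
  have "vertex_operator \<alpha> (\<lambda>w. Re (torsion (Vertex w))) v = vertex_operator \<alpha> vertex_torsion v"
    "vertex_operator \<alpha> (\<lambda>w. Im (torsion (Vertex w))) v = 0" if "v \<in> verts G" for v
    using that by (auto simp: vertex_operator_def torsion_def intro!: arg_cong2[where f="(+)"] sum.cong sum.neutral)
  then have "(\<Sum>p\<in>edge_ends G len v. normal_deriv G len torsion p) + of_real (\<alpha> v) * torsion (Vertex v) = 0"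
    if "v \<in> verts G" for v
    using vertex_condition[OF restrict_torsion_quadratic that, of \<alpha>] vertex_torsion[OF that] that
    by (simp add: complex_eq_iff)
  then show "torsion \<in> laplacian_domain G len \<alpha>"
    using torsion_in_H1 quadratic_weak_deriv(1)[OF length_pos restrict_torsion_quadratic]
    by (simp add: laplacian_domain_def)
  show "AE x in lebesgue_on {0<..<len e}. neg_laplacian G len torsion e x = 1" if e: "e \<in> arcs G"
  proof -
    have "AE x in lebesgue_on {0<..<len e}. weak_deriv (len e) (weak_deriv (len e) (restrict_edge G len torsion e)) x = - 1"
      by (rule quadratic_weak_deriv(3)[OF length_pos[OF e] restrict_torsion_quadratic[OF e]])
    then show ?thesis by eventually_elim (simp add: neg_laplacian_def)
  qed
qed

text \<open>A solution is a parabola on each edge, so it is determined by its vertex values; these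
  solve an injective system. The slope is recovered from the value at the head.\<close>

lemma solution_is_torsion:
  assumes u: "u \<in> laplacian_domain G len \<alpha>"
    and ae: "\<And>e. e \<in> arcs G \<Longrightarrow> AE x in lebesgue_on {0<..<len e}. neg_laplacian G len u e x = 1"
  shows "u = torsion"
proof -
  have uH: "u \<in> H1_graph G len" using u by (simp add: laplacian_domain_def)
  have cont: "continuous_on {0..len e} (restrict_edge G len u e)" if "e \<in> arcs G" for e
    using uH that by (simp add: H1_graph_def continuous_map_graph_space_iff)
  have "\<exists>c. \<forall>t\<in>{0..len e}. restrict_edge G len u e t = restrict_edge G len u e 0 + c * of_real t + (- 1) * (of_real t)\<^sup>2 / 2"
    if e: "e \<in> arcs G" for e
  proof (rule quadratic_of_weak_deriv[OF length_pos[OF e] _ cont[OF e]])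
    show "restrict_edge G len u e \<in> H2 (len e)" using u e by (simp add: laplacian_domain_def)
    show "AE x in lebesgue_on {0<..<len e}. weak_deriv (len e) (weak_deriv (len e) (restrict_edge G len u e)) x = - 1"
      using ae[OF e] by eventually_elim (simp add: neg_laplacian_def equation_minus_iff minus_equation_iff)
  qed
  then obtain c where c: "\<And>e t. e \<in> arcs G \<Longrightarrow> t \<in> {0..len e} \<Longrightarrow>
      restrict_edge G len u e t = u (Vertex (tail G e)) + c e * of_real t + (- 1) * (of_real t)\<^sup>2 / 2"
    using restrict_edge_ends(1) by metis
  have zero: "Complex (vertex_operator \<alpha> (\<lambda>w. Re (u (Vertex w))) v - vertex_load v)
      (vertex_operator \<alpha> (\<lambda>w. Im (u (Vertex w))) v) = 0" if "v \<in> verts G" for v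
    using vertex_condition[OF c that, of \<alpha>] u that by (simp add: laplacian_domain_def)
  \<comment> \<open>The difference of the real parts and the imaginary part itself both lie in the
    kernel of \<open>vertex_operator\<close>.\<close>
  have re: "Re (u (Vertex v)) - vertex_torsion v = 0" if "v \<in> verts G" for v
    using vertex_operator_injective[of "\<lambda>v. Re (u (Vertex v)) - vertex_torsion v"] zero that vertex_torsion
    by (simp add: vertex_operator_diff complex_eq_iff)
  have im: "Im (u (Vertex v)) = 0" if "v \<in> verts G" for v
    using vertex_operator_injective[of "\<lambda>v. Im (u (Vertex v))"] zero that
    by (simp add: complex_eq_iff)
  have vert: "u (Vertex v) = torsion (Vertex v)" if "v \<in> verts G" for v
    using re[OF that] im[OF that] that by (simp add: torsion_def complex_eq_iff)
  have "u (glue G len (e, t)) = torsion (glue G len (e, t))" if e: "e \<in> arcs G" and t: "t \<in> {0..len e}" for e t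
  proof -
    have "c e = of_real (edge_slope e)"
    proof -
      have l: "len e \<in> {0..len e}" "len e \<noteq> 0" using length_pos[OF e] by auto
      have "c e * of_real (len e) = of_real (edge_slope e) * complex_of_real (len e)"
        using c[OF e l(1)] restrict_torsion_quadratic[OF e l(1)] restrict_edge_ends(2)[OF e, of u]
          restrict_edge_ends(2)[OF e, of torsion] vert e by simp
      then show ?thesis using l(2) by simp
    qed
    then show ?thesis
      using c[OF e t] restrict_torsion_quadratic[OF e t] vert e by (simp add: restrict_edge_def)
  qed
  then have "u p = torsion p" if "p \<in> topspace (graph_space G len)" for p
    using topspace_graph_cases[OF that] by metis
  moreover have "u p = torsion p" if "p \<notin> topspace (graph_space G len)" for p
    using uH torsion_in_H1 that by (simp add: H1_graph_def)
  ultimately show ?thesis by blast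
qed

lemma torsion_function_eq: "torsion_function G len \<alpha> = torsion"
  unfolding torsion_function_def
proof (rule the_equality)
  show "torsion \<in> laplacian_domain G len \<alpha> \<and>
      (\<forall>e\<in>arcs G. AE x in lebesgue_on {0<..<len e}. neg_laplacian G len torsion e x = 1)"
    by (intro conjI ballI torsion_is_solution)
  fix u assume "u \<in> laplacian_domain G len \<alpha> \<and>
      (\<forall>e\<in>arcs G. AE x in lebesgue_on {0<..<len e}. neg_laplacian G len u e x = 1)"
  then show "u = torsion"
    by (elim conjE) (rule solution_is_torsion, simp_all only: Ball_def)
qed

end

section \<open>The Picone identity and the extremal functions\<close>

text \<open>Here \<psi> is the logarithmic derivative of \<open>y\<close>. The derivative of \<psi>
  times the squared modulus of \<open>f\<close> is \<open>(cmod (g t))\<^sup>2\<close> minus the two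
  other integrands, so integrating it over the edge leaves the boundary terms.\<close>

lemma Picone_identity:
  fixes f g :: "real \<Rightarrow> complex" and p c l :: real
  assumes "0 < l" and f: "abs_cont l f g" and g: "g \<in> L2 l"
  defines "y \<equiv> \<lambda>t. p + c * t - t\<^sup>2 / 2"
  defines "\<psi> \<equiv> \<lambda>t. (c - t) / y t"
  assumes pos: "\<And>t. t \<in> {0..l} \<Longrightarrow> 0 < y t"
  shows "integrable (lebesgue_on {0<..<l}) (\<lambda>t. (cmod (g t - of_real (\<psi> t) * f t))\<^sup>2)"
    and "(\<integral>t. (cmod (g t))\<^sup>2 \<partial>lebesgue_on {0<..<l}) =
      (\<integral>t. (cmod (f t))\<^sup>2 / y t \<partial>lebesgue_on {0<..<l}) +
      (\<integral>t. (cmod (g t - of_real (\<psi> t) * f t))\<^sup>2 \<partial>lebesgue_on {0<..<l}) +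
      (\<psi> l * (cmod (f l))\<^sup>2 - \<psi> 0 * (cmod (f 0))\<^sup>2)"
proof -
  let ?M = "lebesgue_on {0<..<l}"
  have y0: "y t \<noteq> 0" if "t \<in> {0..l}" for t using pos[OF that] by simp
  have cf: "continuous_on {0..l} f" by (rule abs_cont_continuous[OF f])
  have cy: "continuous_on {0..l} y" unfolding y_def by (intro continuous_intros) auto
  have c\<psi>: "continuous_on {0..l} \<psi>"
    unfolding \<psi>_def using y0 by (intro continuous_intros cy) auto
  have "(\<lambda>t. g t - of_real (\<psi> t) * f t) \<in> L2 l"
    by (intro L2_diff g L2_continuous continuous_intros c\<psi> cf)
  then show d: "integrable ?M (\<lambda>t. (cmod (g t - of_real (\<psi> t) * f t))\<^sup>2)"
    by (simp add: L2_def)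
  have d1: "integrable ?M (\<lambda>t. (cmod (g t))\<^sup>2)" using g by (simp add: L2_def)
  have d2: "integrable ?M (\<lambda>t. (cmod (f t))\<^sup>2 / y t)"
    unfolding integrable_lebesgue_on_Ioo_iff using y0
    by (intro absolutely_integrable_continuous_real continuous_intros cf cy) auto
  \<comment> \<open>The Riccati equation for the logarithmic derivative of \<open>y\<close>, with
    second derivative -1.\<close>
  define \<psi>' where "\<psi>' t = - 1 / y t - (\<psi> t)\<^sup>2" for t
  have "abs_cont l (\<lambda>t. of_real (\<psi> t)) (\<lambda>t. of_real (\<psi>' t))"
  proof (rule abs_cont_of_deriv)
    fix t assume t: "t \<in> {0..l}"
    have "(y has_real_derivative c - t) (at t)"
      unfolding y_def by (auto intro!: derivative_eq_intros)
    then have "(\<psi> has_real_derivative (- 1 * y t - (c - t) * (c - t)) / (y t * y t)) (at t)"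
      unfolding \<psi>_def using y0[OF t] by (auto intro!: derivative_eq_intros)
    moreover have "(- 1 * y t - (c - t) * (c - t)) / (y t * y t) = \<psi>' t"
      using y0[OF t] by (simp add: \<psi>'_def \<psi>_def field_simps power2_eq_square)
    ultimately have "(\<psi> has_real_derivative \<psi>' t) (at t within {0..l})"
      by (auto intro: has_field_derivative_at_within)
    then show "((\<lambda>t. complex_of_real (\<psi> t)) has_vector_derivative of_real (\<psi>' t)) (at t within {0..l})"
      by (rule has_vector_derivative_of_real)
  next
    show "continuous_on {0..l} (\<lambda>t. complex_of_real (\<psi>' t))"
      unfolding \<psi>'_def using y0 by (intro continuous_intros cy c\<psi>) auto
  qed
  \<comment> \<open>The squared modulus is written as \<open>f t * cnj (f t)\<close>, so that the
    product rule applies twice; the real part is taken afterwards.\<close>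
  from abs_cont_mult[OF this abs_cont_mult[OF f abs_cont_cnj[OF f]]]
  have "((\<lambda>t. of_real (\<psi>' t) * (f t * cnj (f t)) + (g t * cnj (f t) + cnj (g t) * f t) * of_real (\<psi> t))
     has_integral of_real (\<psi> l) * (f l * cnj (f l)) - of_real (\<psi> 0) * (f 0 * cnj (f 0))) {0..l}"
    (is "(?k has_integral ?b) _")
    by (rule abs_cont_has_integral) (use \<open>0 < l\<close> in simp_all)
  then have "((\<lambda>t. Re (?k t)) has_integral Re ?b) {0..l}"
    using has_integral_linear[OF _ bounded_linear_Re, of ?k ?b] by (simp only: o_def)
  moreover have "Re (?k t) = (cmod (g t))\<^sup>2 - (cmod (f t))\<^sup>2 / y t - (cmod (g t - of_real (\<psi> t) * f t))\<^sup>2" for t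
  proof -
    have n: "of_real ((cmod z)\<^sup>2) = z * cnj z" for z by (rule complex_norm_square)
    have "complex_of_real ((cmod (g t))\<^sup>2 - (cmod (f t))\<^sup>2 / y t - (cmod (g t - of_real (\<psi> t) * f t))\<^sup>2) = ?k t"
      unfolding of_real_diff of_real_divide n \<psi>'_def
      by (simp add: field_simps power2_eq_square)
    then show ?thesis by (metis Re_complex_of_real)
  qed
  moreover have "Re ?b = \<psi> l * (cmod (f l))\<^sup>2 - \<psi> 0 * (cmod (f 0))\<^sup>2"
  proof -
    have "?b = of_real (\<psi> l * (cmod (f l))\<^sup>2 - \<psi> 0 * (cmod (f 0))\<^sup>2)"
      by (simp only: of_real_diff of_real_mult complex_norm_square)
    then show ?thesis by (simp only: Re_complex_of_real)
  qed
  ultimately have I: "((\<lambda>t. (cmod (g t))\<^sup>2 - (cmod (f t))\<^sup>2 / y t - (cmod (g t - of_real (\<psi> t) * f t))\<^sup>2)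
      has_integral \<psi> l * (cmod (f l))\<^sup>2 - \<psi> 0 * (cmod (f 0))\<^sup>2) {0..l}"
    by simp
  have "((\<lambda>t. (cmod (g t))\<^sup>2 - (cmod (f t))\<^sup>2 / y t - (cmod (g t - of_real (\<psi> t) * f t))\<^sup>2)
      absolutely_integrable_on {0..l})"
    using d d1 d2 by (simp flip: integrable_lebesgue_on_Ioo_iff)
  from integral_lebesgue_on_Ioo[OF this] integral_unique[OF I]
  have "(\<integral>t. (cmod (g t))\<^sup>2 - (cmod (f t))\<^sup>2 / y t - (cmod (g t - of_real (\<psi> t) * f t))\<^sup>2 \<partial>?M) =
      \<psi> l * (cmod (f l))\<^sup>2 - \<psi> 0 * (cmod (f 0))\<^sup>2"
    by simp
  then show "(\<integral>t. (cmod (g t))\<^sup>2 \<partial>?M) = (\<integral>t. (cmod (f t))\<^sup>2 / y t \<partial>?M) +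
      (\<integral>t. (cmod (g t - of_real (\<psi> t) * f t))\<^sup>2 \<partial>?M) +
      (\<psi> l * (cmod (f l))\<^sup>2 - \<psi> 0 * (cmod (f 0))\<^sup>2)"
    using d d1 d2 by simp
qed

section \<open>Energy decomposition on the graph and the case of equality\<close>

context robin_graph
begin

text \<open>The logarithmic derivative \<open>\<upsilon>' / \<upsilon>\<close> on the edge \<open>e\<close>.\<close>

definition log_slope :: "'e \<Rightarrow> real \<Rightarrow> real" where
  "log_slope e t = (edge_slope e - t) / edge_torsion e t"

definition weighted_norm :: "(('v, 'e) point \<Rightarrow> complex) \<Rightarrow> 'e \<Rightarrow> real" where
  "weighted_norm u e = (\<integral>t. (cmod (restrict_edge G len u e t))\<^sup>2 / edge_torsion e t \<partial>lebesgue_on {0<..<len e})"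

text \<open>The integrand is the squared modulus of \<upsilon> times the derivative of u /
  \<upsilon>, so it measures how far u is from a multiple of \<upsilon> on the edge.\<close>

definition defect :: "(('v, 'e) point \<Rightarrow> complex) \<Rightarrow> 'e \<Rightarrow> real" where
  "defect u e = (\<integral>t. (cmod (weak_deriv (len e) (restrict_edge G len u e) t
      - of_real (log_slope e t) * restrict_edge G len u e t))\<^sup>2 \<partial>lebesgue_on {0<..<len e})"

definition rigidity :: real where
  "rigidity = (\<Sum>e\<in>arcs G. \<integral>t. edge_torsion e t \<partial>lebesgue_on {0<..<len e})"

lemma continuous_edge_torsion: "continuous_on S (edge_torsion e)"
  unfolding edge_torsion_def[abs_def] by (intro continuous_intros) auto

lemma H1_graph_edge:
  assumes "u \<in> H1_graph G len" "e \<in> arcs G"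
  shows "continuous_on {0..len e} (restrict_edge G len u e)"
    and "weak_deriv (len e) (restrict_edge G len u e) \<in> L2 (len e)"
    and "abs_cont (len e) (restrict_edge G len u e) (weak_deriv (len e) (restrict_edge G len u e))"
proof -
  show c: "continuous_on {0..len e} (restrict_edge G len u e)"
    using assms by (simp add: H1_graph_def continuous_map_graph_space_iff)
  have h: "restrict_edge G len u e \<in> H1 (len e)" using assms by (simp add: H1_graph_def)
  show "weak_deriv (len e) (restrict_edge G len u e) \<in> L2 (len e)" by (rule H1_weak_deriv(1)[OF h])
  show "abs_cont (len e) (restrict_edge G len u e) (weak_deriv (len e) (restrict_edge G len u e))"
    by (rule H1_continuous_abs_cont[OF length_pos[OF assms(2)] h c])
qed

text \<open>At each end the boundary term is \<open>w / \<upsilon>\<close> times the normal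
  derivative of \<upsilon>. Collected at a vertex, the normal derivatives sum to minus the strength
  times \<upsilon>, and \<upsilon> cancels.\<close>

lemma boundary_terms:
  fixes w :: "'v \<Rightarrow> real"
  shows "(\<Sum>e\<in>arcs G. log_slope e (len e) * w (head G e) - log_slope e 0 * w (tail G e)) +
    (\<Sum>v\<in>verts G. \<alpha> v * w v) = 0"
proof -
  let ?x = vertex_torsion
  \<comment> \<open>This factor depends on the vertex only, so it can be pulled out of the sum over
    the edge ends at \<open>v\<close>.\<close>
  define k where "k v = w v / ?x v" for v
  have x0: "?x v \<noteq> 0" if "v \<in> verts G" for v using vertex_torsion_pos[OF that] by simp
  have "(\<Sum>e\<in>arcs G. log_slope e (len e) * w (head G e) - log_slope e 0 * w (tail G e)) =
      (\<Sum>e\<in>arcs G. k (tail G e) * ((?x (tail G e) - ?x (head G e)) / len e - len e / 2) +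
         k (head G e) * ((?x (head G e) - ?x (tail G e)) / len e - len e / 2))"
  proof (intro sum.cong refl)
    fix e assume e: "e \<in> arcs G"
    have "log_slope e (len e) * w (head G e) = k (head G e) * ((?x (head G e) - ?x (tail G e)) / len e - len e / 2)"
      using edge_torsion_ends[OF e] by (simp add: log_slope_def k_def edge_slope_def mult.commute)
    moreover have "log_slope e 0 * w (tail G e) = - (k (tail G e) * ((?x (tail G e) - ?x (head G e)) / len e - len e / 2))"
      using edge_torsion_ends[OF e] x0[OF tail_in_verts[OF e]] length_pos[OF e]
      by (simp add: log_slope_def k_def edge_slope_def field_simps)
    ultimately show "log_slope e (len e) * w (head G e) - log_slope e 0 * w (tail G e) =
        k (tail G e) * ((?x (tail G e) - ?x (head G e)) / len e - len e / 2) +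
         k (head G e) * ((?x (head G e) - ?x (tail G e)) / len e - len e / 2)"
      by linarith
  qed
  also have "\<dots> = (\<Sum>v\<in>verts G. \<Sum>e | e \<in> arcs G \<and> tail G e = v. k v * ((?x v - ?x (head G e)) / len e - len e / 2)) +
      (\<Sum>v\<in>verts G. \<Sum>e | e \<in> arcs G \<and> head G e = v. k v * ((?x v - ?x (tail G e)) / len e - len e / 2))"
    by (simp only: sum_tail[of "\<lambda>v e. k v * ((?x v - ?x (head G e)) / len e - len e / 2)"]
        sum_head[of "\<lambda>v e. k v * ((?x v - ?x (tail G e)) / len e - len e / 2)"] sum.distrib)
  also have "\<dots> = (\<Sum>v\<in>verts G. k v * (vertex_operator \<alpha> ?x v - \<alpha> v * ?x v - vertex_load v))"
    unfolding sum.distrib[symmetric] sum_distrib_left[symmetric] distrib_left[symmetric] sum_subtractf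
    by (intro sum.cong arg_cong2[where f="(*)"] refl) (simp add: vertex_operator_def vertex_load_def)
  also have "\<dots> = - (\<Sum>v\<in>verts G. \<alpha> v * w v)"
    unfolding sum_negf[symmetric]
    by (intro sum.cong refl) (use x0 in \<open>simp add: vertex_torsion k_def\<close>)
  finally show ?thesis by simp
qed

lemma energy_decomposition:
  assumes u: "u \<in> H1_graph G len"
  shows "energy_form G len \<alpha> u = (\<Sum>e\<in>arcs G. weighted_norm u e) + (\<Sum>e\<in>arcs G. defect u e)"
proof -
  let ?f = "restrict_edge G len u"
  let ?w = "\<lambda>v. (cmod (u (Vertex v)))\<^sup>2"
  have "(\<integral>t. (cmod (weak_deriv (len e) (?f e) t))\<^sup>2 \<partial>lebesgue_on {0<..<len e}) =
      weighted_norm u e + defect u e + (log_slope e (len e) * ?w (head G e) - log_slope e 0 * ?w (tail G e))"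
    if e: "e \<in> arcs G" for e
    using Picone_identity(2)[OF length_pos[OF e] H1_graph_edge(3)[OF u e] H1_graph_edge(2)[OF u e],
        of "vertex_torsion (tail G e)" "edge_slope e"]
      edge_torsion_pos[OF e] restrict_edge_ends[OF e, of u]
    unfolding edge_torsion_def[symmetric] log_slope_def[symmetric] weighted_norm_def defect_def by simp
  then have "energy_form G len \<alpha> u = (\<Sum>e\<in>arcs G. weighted_norm u e + defect u e +
      (log_slope e (len e) * ?w (head G e) - log_slope e 0 * ?w (tail G e))) + (\<Sum>v\<in>verts G. \<alpha> v * ?w v)"
    by (simp add: energy_form_def)
  then show ?thesis
    using boundary_terms[of ?w] by (simp add: sum.distrib)
qed

text \<open>Integrability of the three terms into which the square in the Cauchy-Schwarz argument is
  expanded.\<close>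

lemma edge_integrals:
  assumes u: "u \<in> H1_graph G len" and e: "e \<in> arcs G"
  shows "integrable (lebesgue_on {0<..<len e}) (edge_torsion e)"
    and "integrable (lebesgue_on {0<..<len e}) (\<lambda>t. cmod (restrict_edge G len u e t))"
    and "integrable (lebesgue_on {0<..<len e}) (\<lambda>t. (cmod (restrict_edge G len u e t))\<^sup>2 / edge_torsion e t)"
proof -
  have "edge_torsion e t \<noteq> 0" if "t \<in> {0..len e}" for t using edge_torsion_pos[OF e that] by simp
  then show "integrable (lebesgue_on {0<..<len e}) (edge_torsion e)"
    "integrable (lebesgue_on {0<..<len e}) (\<lambda>t. cmod (restrict_edge G len u e t))"
    "integrable (lebesgue_on {0<..<len e}) (\<lambda>t. (cmod (restrict_edge G len u e t))\<^sup>2 / edge_torsion e t)"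
    unfolding integrable_lebesgue_on_Ioo_iff
    by (intro absolutely_integrable_continuous_real continuous_intros continuous_edge_torsion H1_graph_edge(1)[OF u e]; simp)+
qed

lemma L1_norm_eq: "L1_norm G len u = (\<Sum>e\<in>arcs G. \<integral>t. cmod (restrict_edge G len u e t) \<partial>lebesgue_on {0<..<len e})"
  by (simp add: L1_norm_def graph_integral_def restrict_edge_def)

lemma rigidity_pos: "0 < rigidity"
proof -
  have "0 < (\<integral>t. edge_torsion e t \<partial>lebesgue_on {0<..<len e})" if e: "e \<in> arcs G" for e
  proof -
    let ?I = "integral {0..len e} (edge_torsion e)"
    have "0 \<le> ?I"
      using edge_torsion_pos[OF e]
      by (intro Henstock_Kurzweil_Integration.integral_nonneg integrable_continuous_real continuous_edge_torsion)
        (auto intro: less_imp_le)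
    moreover have "?I \<noteq> 0"
    proof
      assume "?I = 0"
      then have "\<forall>t\<in>{0..len e}. edge_torsion e t = 0"
        using edge_torsion_pos[OF e] by (subst (asm) integral_eq_0_iff[OF continuous_edge_torsion length_pos[OF e]]) (auto intro: less_imp_le)
      then show False using edge_torsion_pos[OF e, of 0] length_pos[OF e] by simp
    qed
    ultimately show ?thesis
      using integral_lebesgue_on_Ioo[OF absolutely_integrable_continuous_real[OF continuous_edge_torsion]] by simp
  qed
  moreover have "arcs G \<noteq> {}" using strength_nontrivial verts_incident by blast
  ultimately show ?thesis unfolding rigidity_def by (intro sum_pos) auto
qed

text \<open>The quadratic polynomial \<open>\<integral> (\<bar>u\<bar> - s \<upsilon>)\<^sup>2 / \<upsilon>\<close> in \<open>s\<close> is nonnegative; its value at the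
  minimiser gives the Cauchy-Schwarz inequality.\<close>

lemma L1_norm_le_weighted:
  assumes u: "u \<in> H1_graph G len"
  shows "(L1_norm G len u)\<^sup>2 \<le> rigidity * (\<Sum>e\<in>arcs G. weighted_norm u e)"
proof -
  define A B where "A = L1_norm G len u" and "B = (\<Sum>e\<in>arcs G. weighted_norm u e)"
  have "0 \<le> B - 2 * s * A + s\<^sup>2 * rigidity" for s
  proof -
    have "0 \<le> weighted_norm u e - 2 * s * (\<integral>t. cmod (restrict_edge G len u e t) \<partial>lebesgue_on {0<..<len e})
        + s\<^sup>2 * (\<integral>t. edge_torsion e t \<partial>lebesgue_on {0<..<len e})" if e: "e \<in> arcs G" for e
    proof -
      let ?n = "\<lambda>t. cmod (restrict_edge G len u e t)" and ?y = "edge_torsion e" and ?M = "lebesgue_on {0<..<len e}"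
      have "0 \<le> (\<integral>t. (?n t - s * ?y t)\<^sup>2 / ?y t \<partial>?M)"
        by (rule Bochner_Integration.integral_nonneg)
          (use edge_torsion_pos[OF e] in \<open>auto intro!: divide_nonneg_pos\<close>)
      also have "\<dots> = (\<integral>t. (?n t)\<^sup>2 / ?y t - 2 * s * ?n t + s\<^sup>2 * ?y t \<partial>?M)"
      proof (rule Bochner_Integration.integral_cong[OF refl])
        fix t assume "t \<in> space ?M"
        then have "?y t \<noteq> 0" using edge_torsion_pos[OF e, of t] by simp
        then show "(?n t - s * ?y t)\<^sup>2 / ?y t = (?n t)\<^sup>2 / ?y t - 2 * s * ?n t + s\<^sup>2 * ?y t"
          by (simp add: field_simps power2_eq_square)
      qed
      also have "\<dots> = weighted_norm u e - 2 * s * (\<integral>t. ?n t \<partial>?M) + s\<^sup>2 * (\<integral>t. ?y t \<partial>?M)"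
        using edge_integrals[OF u e] by (simp add: weighted_norm_def)
      finally show ?thesis .
    qed
    then have "0 \<le> (\<Sum>e\<in>arcs G. weighted_norm u e - 2 * s * (\<integral>t. cmod (restrict_edge G len u e t) \<partial>lebesgue_on {0<..<len e})
        + s\<^sup>2 * (\<integral>t. edge_torsion e t \<partial>lebesgue_on {0<..<len e}))"
      by (rule sum_nonneg)
    also have "\<dots> = B - 2 * s * A + s\<^sup>2 * rigidity"
      by (simp add: A_def B_def L1_norm_eq rigidity_def sum.distrib sum_subtractf sum_distrib_left)
    finally show ?thesis .
  qed
  from this[of "A / rigidity"] have "A\<^sup>2 \<le> rigidity * B"
    using rigidity_pos by (simp add: field_simps power2_eq_square)
  then show ?thesis by (simp add: A_def B_def)
qed

lemma defect_nonneg: "0 \<le> defect u e"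
  by (simp add: defect_def)

lemma weighted_norm_nonneg: "e \<in> arcs G \<Longrightarrow> 0 \<le> weighted_norm u e"
  unfolding weighted_norm_def
  by (rule Bochner_Integration.integral_nonneg) (use edge_torsion_pos in \<open>auto intro!: divide_nonneg_pos\<close>)

lemma torsion_quotient_le:
  assumes u: "u \<in> H1_graph G len"
  shows "torsion_quotient G len \<alpha> u \<le> rigidity"
proof -
  let ?B = "\<Sum>e\<in>arcs G. weighted_norm u e" and ?D = "\<Sum>e\<in>arcs G. defect u e"
  have "0 \<le> ?B" "0 \<le> ?D" by (auto intro: sum_nonneg defect_nonneg weighted_norm_nonneg)
  have "(L1_norm G len u)\<^sup>2 \<le> rigidity * ?B" by (rule L1_norm_le_weighted[OF u])
  also have "\<dots> \<le> rigidity * energy_form G len \<alpha> u"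
    using rigidity_pos \<open>0 \<le> ?D\<close> by (simp add: energy_decomposition[OF u])
  finally have le: "(L1_norm G len u)\<^sup>2 \<le> rigidity * energy_form G len \<alpha> u" .
  have "0 \<le> energy_form G len \<alpha> u"
    using \<open>0 \<le> ?B\<close> \<open>0 \<le> ?D\<close> by (simp add: energy_decomposition[OF u])
  \<comment> \<open>In the first case the quotient is 0 by the convention for division by
    zero.\<close>
  then consider "energy_form G len \<alpha> u = 0" | "0 < energy_form G len \<alpha> u" by linarith
  then show ?thesis
    using le rigidity_pos by cases (simp_all add: torsion_quotient_def divide_simps)
qed

lemma multiple_of_torsion_if_extremal:
  assumes u: "u \<in> H1_graph G len" and max: "torsion_quotient G len \<alpha> u = rigidity"
  shows "\<exists>c. u = (\<lambda>p. c * torsion p)"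
proof -
  let ?f = "restrict_edge G len u" and ?y = edge_torsion
  let ?B = "\<Sum>e\<in>arcs G. weighted_norm u e" and ?D = "\<Sum>e\<in>arcs G. defect u e"
  \<comment> \<open>Otherwise division by zero would give the quotient 0, but
    \<open>rigidity\<close> is positive.\<close>
  have "energy_form G len \<alpha> u \<noteq> 0"
    using max rigidity_pos by (auto simp: torsion_quotient_def)
  then have "rigidity * energy_form G len \<alpha> u = (L1_norm G len u)\<^sup>2"
    using max by (simp add: torsion_quotient_def field_simps)
  also have "\<dots> \<le> rigidity * ?B" by (rule L1_norm_le_weighted[OF u])
  \<comment> \<open>The energy is \<open>?B + ?D\<close>, so the chain bounds
    \<open>rigidity * (?B + ?D)\<close> by \<open>rigidity * ?B\<close>.\<close>
  finally have "?D \<le> 0"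
    using rigidity_pos by (simp add: energy_decomposition[OF u])
  then have "?D = 0"
    using sum_nonneg[of "arcs G" "defect u"] defect_nonneg by (simp add: antisym)
  then have d0: "defect u e = 0" if "e \<in> arcs G" for e
    using that by (simp add: sum_nonneg_eq_0_iff defect_nonneg)
  have const: "?f e t / of_real (?y e t) = ?f e 0 / of_real (?y e 0)" if e: "e \<in> arcs G" and t: "t \<in> {0..len e}" for e t
  proof -
    let ?g = "weak_deriv (len e) (?f e)" and ?M = "lebesgue_on {0<..<len e}"
    have y0: "?y e t \<noteq> 0" if "t \<in> {0..len e}" for t using edge_torsion_pos[OF e that] by simp
    have "AE t in ?M. (cmod (?g t - of_real (log_slope e t) * ?f e t))\<^sup>2 = 0"
    proof (subst integral_nonneg_eq_0_iff_AE[symmetric])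
      show "integrable ?M (\<lambda>t. (cmod (?g t - of_real (log_slope e t) * ?f e t))\<^sup>2)"
        using Picone_identity(1)[OF length_pos[OF e] H1_graph_edge(3)[OF u e] H1_graph_edge(2)[OF u e],
            of "vertex_torsion (tail G e)" "edge_slope e"] edge_torsion_pos[OF e]
        unfolding edge_torsion_def[symmetric] log_slope_def[symmetric] by simp
    qed (use d0[OF e] in \<open>auto simp: defect_def\<close>)
    then have ae: "AE t in ?M. ?g t = of_real (log_slope e t) * ?f e t"
      by eventually_elim simp
    \<comment> \<open>The derivative of \<open>1 / \<upsilon>\<close>: the product rule for u and
      \<open>1 / \<upsilon>\<close> replaces a quotient rule, and the vanishing defect makes the
      resulting derivative zero almost everywhere.\<close>
    define r' where "r' t = - (edge_slope e - t) / (?y e t)\<^sup>2" for t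
    have r: "abs_cont (len e) (\<lambda>t. of_real (1 / ?y e t)) (\<lambda>t. of_real (r' t))"
    proof (rule abs_cont_of_deriv)
      fix t assume t: "t \<in> {0..len e}"
      have "(?y e has_real_derivative edge_slope e - t) (at t)"
        unfolding edge_torsion_def[abs_def] by (auto intro!: derivative_eq_intros)
      then have "((\<lambda>t. 1 / ?y e t) has_real_derivative r' t) (at t)"
        using y0[OF t] by (auto intro!: derivative_eq_intros simp: r'_def power2_eq_square)
      then show "((\<lambda>t. complex_of_real (1 / ?y e t)) has_vector_derivative of_real (r' t)) (at t within {0..len e})"
        by (rule has_vector_derivative_of_real[OF has_field_derivative_at_within])
    next
      show "continuous_on {0..len e} (\<lambda>t. complex_of_real (r' t))"
        unfolding r'_def using y0 by (intro continuous_intros continuous_edge_torsion) auto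
    qed
    have "abs_cont (len e) (\<lambda>t. ?f e t * of_real (1 / ?y e t)) (\<lambda>t. 0)"
    proof (rule abs_cont_cong_AE[OF abs_cont_mult[OF H1_graph_edge(3)[OF u e] r]])
      have z: "AE t in ?M. t \<in> {0..len e}"
        by (rule AE_I2) auto
      show "AE t in ?M. ?g t * of_real (1 / ?y e t) + of_real (r' t) * ?f e t = 0"
        using ae z
      proof eventually_elim
        case (elim t)
        then show ?case using y0[of t] by (simp add: log_slope_def r'_def field_simps power2_eq_square)
      qed
    qed simp
    then have "((\<lambda>t. 0) has_integral ?f e t * of_real (1 / ?y e t) - ?f e 0 * of_real (1 / ?y e 0)) {0..t}"
      by (rule abs_cont_has_integral) (use t in auto)
    then have "?f e t * of_real (1 / ?y e t) - ?f e 0 * of_real (1 / ?y e 0) = 0"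
      by (rule has_integral_unique[OF _ has_integral_0])
    then show ?thesis by simp
  qed
  \<comment> \<open>The ratio u / \<upsilon> at vertices; by \<open>const\<close> it agrees at the
    two ends of every edge, so connectedness makes it constant.\<close>
  define k where "k v = u (Vertex v) / of_real (vertex_torsion v)" for v
  have k: "k (tail G e) = k (head G e)" if e: "e \<in> arcs G" for e
    using const[OF e, of "len e"] length_pos[OF e] restrict_edge_ends[OF e, of u] edge_torsion_ends[OF e]
    by (simp add: k_def)
  obtain v where v: "v \<in> verts G" using strength_nontrivial by blast
  have "u (glue G len (e, t)) = k v * torsion (glue G len (e, t))" if e: "e \<in> arcs G" and t: "t \<in> {0..len e}" for e t
  proof -
    have "?f e 0 / of_real (?y e 0) = k (tail G e)"
      using restrict_edge_ends(1)[OF e, of u] edge_torsion_ends(1)[OF e] by (simp add: k_def)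
    also have "\<dots> = k v"
      using constant_on_verts[OF connected k, of "tail G e" v] e v by simp
    finally have "?f e t = k v * of_real (?y e t)"
      using const[OF e t] edge_torsion_pos[OF e t] by (simp add: field_simps)
    then show ?thesis using restrict_torsion[OF e t] by (simp add: restrict_edge_def)
  qed
  then have "u p = k v * torsion p" if "p \<in> topspace (graph_space G len)" for p
    using topspace_graph_cases[OF that] by metis
  moreover have "u p = k v * torsion p" if "p \<notin> topspace (graph_space G len)" for p
    using u torsion_in_H1 that by (simp add: H1_graph_def)
  ultimately show ?thesis by blast
qed

text \<open>The energy is obtained from the decomposition: the defect vanishes and the weighted
  norms add up to \<open>(cmod c)\<^sup>2 * rigidity\<close>, while the squared norm in the
  numerator carries \<open>rigidity\<close> twice.\<close>

lemma torsion_quotient_multiple: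
  assumes "c \<noteq> 0"
  shows "torsion_quotient G len \<alpha> (\<lambda>p. c * torsion p) = rigidity"
proof -
  let ?u = "\<lambda>p. c * torsion p" and ?y = edge_torsion
  have u: "?u \<in> H1_graph G len" by (rule multiple_of_torsion_in_H1)
  have f: "restrict_edge G len ?u e t = c * of_real (?y e t)" if "e \<in> arcs G" "t \<in> {0..len e}" for e t
    using restrict_torsion[OF that] by (simp add: restrict_edge_def)
  have "weighted_norm ?u e = (cmod c)\<^sup>2 * (\<integral>t. ?y e t \<partial>lebesgue_on {0<..<len e})" if e: "e \<in> arcs G" for e
  proof -
    have "weighted_norm ?u e = (\<integral>t. (cmod c)\<^sup>2 * ?y e t \<partial>lebesgue_on {0<..<len e})"
      unfolding weighted_norm_def
    proof (rule Bochner_Integration.integral_cong[OF refl])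
      fix t assume "t \<in> space (lebesgue_on {0<..<len e})"
      then have t: "t \<in> {0..len e}" by simp
      show "(cmod (restrict_edge G len ?u e t))\<^sup>2 / ?y e t = (cmod c)\<^sup>2 * ?y e t"
        using edge_torsion_pos[OF e t] by (simp add: f[OF e t] norm_mult power2_eq_square)
    qed
    then show ?thesis by simp
  qed
  then have B: "(\<Sum>e\<in>arcs G. weighted_norm ?u e) = (cmod c)\<^sup>2 * rigidity"
    by (simp add: rigidity_def sum_distrib_left)
  have "(\<integral>t. cmod (restrict_edge G len ?u e t) \<partial>lebesgue_on {0<..<len e}) =
      cmod c * (\<integral>t. ?y e t \<partial>lebesgue_on {0<..<len e})" if e: "e \<in> arcs G" for e
  proof -
    have "(\<integral>t. cmod (restrict_edge G len ?u e t) \<partial>lebesgue_on {0<..<len e}) =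
        (\<integral>t. cmod c * ?y e t \<partial>lebesgue_on {0<..<len e})"
    proof (rule Bochner_Integration.integral_cong[OF refl])
      fix t assume "t \<in> space (lebesgue_on {0<..<len e})"
      then have t: "t \<in> {0..len e}" by simp
      show "cmod (restrict_edge G len ?u e t) = cmod c * ?y e t"
        using edge_torsion_pos[OF e t] by (simp add: f[OF e t] norm_mult)
    qed
    then show ?thesis by simp
  qed
  then have A: "L1_norm G len ?u = cmod c * rigidity"
    by (simp add: L1_norm_eq rigidity_def sum_distrib_left)
  have "defect ?u e = 0" if e: "e \<in> arcs G" for e
  proof -
    have "AE t in lebesgue_on {0<..<len e}. weak_deriv (len e) (restrict_edge G len ?u e) t =
        c * of_real (edge_slope e) + (- c) * of_real t"
      by (rule quadratic_weak_deriv(2)[OF length_pos[OF e] restrict_multiple_of_torsion[OF e]])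
    moreover have "AE t in lebesgue_on {0<..<len e}. t \<in> {0..len e}"
      by (rule AE_I2) auto
    ultimately have "AE t in lebesgue_on {0<..<len e}. (cmod (weak_deriv (len e) (restrict_edge G len ?u e) t
      - of_real (log_slope e t) * restrict_edge G len ?u e t))\<^sup>2 = 0"
    proof eventually_elim
      case (elim t)
      \<comment> \<open>The logarithmic derivative of \<upsilon> times \<upsilon> gives back the
        derivative of \<upsilon>.\<close>
      have *: "of_real (log_slope e t) * (c * of_real (?y e t)) = c * of_real (edge_slope e - t)"
        using edge_torsion_pos[OF e elim(2)] by (simp add: log_slope_def)
      from elim show ?case
        by (simp add: f[OF e elim(2)] *) (simp add: algebra_simps)
    qed
    then show ?thesis unfolding defect_def by (rule integral_eq_zero_AE)
  qed
  then have "energy_form G len \<alpha> ?u = (cmod c)\<^sup>2 * rigidity"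
    by (simp add: energy_decomposition[OF u] B)
  then show ?thesis
    using A assms rigidity_pos by (simp add: torsion_quotient_def power2_eq_square)
qed

lemma torsional_rigidity_eq: "torsional_rigidity G len \<alpha> = complex_of_real rigidity"
proof -
  have "(\<integral>t. restrict_edge G len torsion e t \<partial>lebesgue_on {0<..<len e}) =
      complex_of_real (\<integral>t. edge_torsion e t \<partial>lebesgue_on {0<..<len e})" if e: "e \<in> arcs G" for e
    unfolding integral_complex_of_real[symmetric]
    by (rule Bochner_Integration.integral_cong[OF refl]) (simp add: restrict_torsion[OF e])
  then show ?thesis
    by (simp add: torsional_rigidity_def torsion_function_eq graph_integral_def rigidity_def)
qed

lemma multiple_of_torsion_nonzero:
  assumes "c \<noteq> 0"
  shows "(\<lambda>p. c * torsion p) \<noteq> (\<lambda>p. 0)"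
proof -
  obtain v where "v \<in> verts G" using strength_nontrivial by blast
  then have "c * torsion (Vertex v) \<noteq> 0"
    using assms vertex_torsion_pos[of v] by (simp add: torsion_def)
  then show ?thesis by (auto simp: fun_eq_iff)
qed

text \<open>The upper bound \<open>rigidity\<close> is attained by the torsion function, so being
  maximal means attaining this value.\<close>

lemma is_arg_max_torsion_quotient_iff:
  assumes "u \<in> H1_graph G len - {\<lambda>p. 0}"
  shows "is_arg_max (torsion_quotient G len \<alpha>) (\<lambda>u. u \<in> H1_graph G len - {\<lambda>p. 0}) u \<longleftrightarrow>
    torsion_quotient G len \<alpha> u = rigidity"
proof
  assume "is_arg_max (torsion_quotient G len \<alpha>) (\<lambda>u. u \<in> H1_graph G len - {\<lambda>p. 0}) u"
  then have "\<not> torsion_quotient G len \<alpha> u < torsion_quotient G len \<alpha> (\<lambda>p. 1 * torsion p)"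
    using multiple_of_torsion_in_H1[of 1] multiple_of_torsion_nonzero[OF one_neq_zero] unfolding is_arg_max_def by blast
  then have "rigidity \<le> torsion_quotient G len \<alpha> u"
    by (simp only: torsion_quotient_multiple[OF one_neq_zero] not_less)
  then show "torsion_quotient G len \<alpha> u = rigidity"
    using torsion_quotient_le[of u] assms by simp
next
  assume "torsion_quotient G len \<alpha> u = rigidity"
  then show "is_arg_max (torsion_quotient G len \<alpha>) (\<lambda>u. u \<in> H1_graph G len - {\<lambda>p. 0}) u"
    using assms torsion_quotient_le by (fastforce simp: is_arg_max_def not_less)
qed

lemma extremal_iff:
  assumes "u \<in> H1_graph G len - {\<lambda>p. 0}"
  shows "torsion_quotient G len \<alpha> u = rigidity \<longleftrightarrow> (\<exists>c. c \<noteq> 0 \<and> u = (\<lambda>p. c * torsion p))"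
proof
  assume "torsion_quotient G len \<alpha> u = rigidity"
  then obtain c where "u = (\<lambda>p. c * torsion p)"
    using multiple_of_torsion_if_extremal assms by blast
  then show "\<exists>c. c \<noteq> 0 \<and> u = (\<lambda>p. c * torsion p)"
    using assms by (cases "c = 0") auto
qed (auto simp: torsion_quotient_multiple)

end

theorem theorem3p1:
  fixes G :: "('v, 'e) pre_digraph" and len :: "'e \<Rightarrow> real" and \<alpha> :: "'v \<Rightarrow> real"
  assumes "metric_graph G len"
    and "path_connected_space (graph_space G len)"
    and "\<And>v. v \<in> verts G \<Longrightarrow> 0 \<le> \<alpha> v"
    and "\<exists>v\<in>verts G. 0 < \<alpha> v"
  shows "torsional_rigidity G len \<alpha> =
      complex_of_real (SUP u\<in>H1_graph G len - {\<lambda>p. 0}. torsion_quotient G len \<alpha> u) \<and>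
    (\<exists>u. is_arg_max (torsion_quotient G len \<alpha>) (\<lambda>u. u \<in> H1_graph G len - {\<lambda>p. 0}) u \<and>
      torsional_rigidity G len \<alpha> = complex_of_real (torsion_quotient G len \<alpha> u)) \<and>
    (\<forall>u\<in>H1_graph G len - {\<lambda>p. 0}.
      is_arg_max (torsion_quotient G len \<alpha>) (\<lambda>u. u \<in> H1_graph G len - {\<lambda>p. 0}) u \<longleftrightarrow>
      (\<exists>c. c \<noteq> 0 \<and> u = (\<lambda>p. c * torsion_function G len \<alpha> p)))"
proof -
  interpret robin_graph G len \<alpha>
    by (rule robin_graph.intro[OF assms(1) robin_graph_axioms.intro[OF assms(2-4)]])
  let ?H = "H1_graph G len - {\<lambda>p. 0}"
  \<comment> \<open>The factor 1 keeps the shape of the facts about multiples of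
    \<open>torsion\<close>.\<close>
  let ?t = "\<lambda>p. 1 * torsion p"
  have t: "?t \<in> ?H"
    using multiple_of_torsion_in_H1[of 1] multiple_of_torsion_nonzero[OF one_neq_zero] by blast
  have max: "torsion_quotient G len \<alpha> ?t = rigidity"
    by (rule torsion_quotient_multiple) simp
  \<comment> \<open>The bound is attained, so the supremum is the greatest element of the set of
    values.\<close>
  have "(SUP u\<in>?H. torsion_quotient G len \<alpha> u) = rigidity"
    using t max torsion_quotient_le by (intro cSup_eq_maximum) (auto intro!: image_eqI[of _ _ ?t])
  moreover have "is_arg_max (torsion_quotient G len \<alpha>) (\<lambda>u. u \<in> ?H) ?t"
    using is_arg_max_torsion_quotient_iff[OF t] max by blast
  ultimately show ?thesis
    unfolding torsional_rigidity_eq torsion_function_eq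
    using is_arg_max_torsion_quotient_iff extremal_iff max by (metis (no_types, lifting))
qed

end
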